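(* Let $\alpha>-1$, let $\varphi:\mathbb{D}\to\mathbb{D}$ be holomorphic and let $h\in\mathcal{A}^2_\alpha(\mathbb{D})$. Then there exists a finite positive Borel measure $\mu$ on $\overline{\mathbb{D}}$ such that $$\|W_{h,\varphi}f\|_{\mathcal{A}^2_\alpha}^2=\int_{\overline{\mathbb{D}}}|f(z)|^2\,d\mu(z)$$ for all functions $f$ analytic in a neighbourhood of $\overline{\mathbb{D}}$. Thus $\|W_{h,\varphi}f\|=\|I_\mu f\|$ for such $f$, where $I_\mu:\mathcal{A}^2_\alpha(\mathbb{D})\to L^2(\overline{\mathbb{D}},\mu)$ is the canonical Carleson embedding. It follows that $W_{h,\varphi}$ (on $\mathcal{A}^2_\alpha(\mathbb{D})$) is respectively bounded, compact, or of Schatten class $S_p$ ($1\le p<\infty$) if and only if $I_\mu$ has the same property.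
   Context: $\mathbb{D}$ is the open unit disc in $\mathbb{C}$, $\overline{\mathbb{D}}$ its closure, and $dA$ area measure. For $\alpha>-1$, the weighted Bergman space $\mathcal{A}^2_\alpha(\mathbb{D})$ is the Hilbert space of analytic $f$ on $\mathbb{D}$ with $\|f\|_{\mathcal{A}^2_\alpha}=\left(\frac1\pi\int_{\mathbb{D}}|f(z)|^2(1-|z|^2)^\alpha\,dA(z)\right)^{1/2}<\infty$. The weighted composition operator is $W_{h,\varphi}f(z)=h(z)f(\varphi(z))$. The canonical Carleson embedding $I_\mu$ sends $f$ to $f$ regarded as an element of $L^2(\overline{\mathbb{D}},\mu)$; it is defined initially on the functions analytic in a neighbourhood of $\overline{\mathbb{D}}$ (a dense subspace of $\mathcal{A}^2_\alpha(\mathbb{D})$), and to say that it is bounded, compact or in $S_p$ means that it extends to an operator on $\mathcal{A}^2_\alpha(\mathbb{D})$ with that property. *)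

theory Defs
  imports "HOL-Analysis.Analysis"
begin

section \<open>Hilbert spaces of functions\<close>

text \<open>
  A Hilbert space of (classes of) functions is given by the set of its representatives and the
  inner product, linear in the first argument.  The inner product is only semidefinite on
  representatives: \<open>f\<close> and \<open>g\<close> stand for the same vector iff \<open>hnorm H (f - g) = 0\<close> (they agree on
  the open disc in the Bergman space, and almost everywhere in an L2 space).  The notions below do
  not depend on the choice of representatives.
\<close>

record fun_hilbert =
  vecs :: "(complex \<Rightarrow> complex) set"
  ip :: "(complex \<Rightarrow> complex) \<Rightarrow> (complex \<Rightarrow> complex) \<Rightarrow> complex"

definition hnorm :: "fun_hilbert \<Rightarrow> (complex \<Rightarrow> complex) \<Rightarrow> real" where
  "hnorm H f = sqrt (Re (ip H f f))"

definition linear_op ::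
  "fun_hilbert \<Rightarrow> fun_hilbert \<Rightarrow> ((complex \<Rightarrow> complex) \<Rightarrow> (complex \<Rightarrow> complex)) \<Rightarrow> bool" where
  "linear_op H K T \<longleftrightarrow>
     (\<forall>f \<in> vecs H. T f \<in> vecs K) \<and>
     (\<forall>f \<in> vecs H. \<forall>g \<in> vecs H. \<forall>a b.
        hnorm K (\<lambda>z. T (\<lambda>w. a * f w + b * g w) z - (a * T f z + b * T g z)) = 0)"

definition bounded_op ::
  "fun_hilbert \<Rightarrow> fun_hilbert \<Rightarrow> ((complex \<Rightarrow> complex) \<Rightarrow> (complex \<Rightarrow> complex)) \<Rightarrow> bool" where
  "bounded_op H K T \<longleftrightarrow>
     linear_op H K T \<and> (\<exists>C. \<forall>f \<in> vecs H. hnorm K (T f) \<le> C * hnorm H f)"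

definition compact_op ::
  "fun_hilbert \<Rightarrow> fun_hilbert \<Rightarrow> ((complex \<Rightarrow> complex) \<Rightarrow> (complex \<Rightarrow> complex)) \<Rightarrow> bool" where
  "compact_op H K T \<longleftrightarrow>
     bounded_op H K T \<and>
     (\<forall>f :: nat \<Rightarrow> complex \<Rightarrow> complex.
        (\<forall>n. f n \<in> vecs H) \<and> (\<exists>B. \<forall>n. hnorm H (f n) \<le> B) \<longrightarrow>
        (\<exists>r g. strict_mono r \<and> g \<in> vecs K \<and>
               (\<lambda>n. hnorm K (\<lambda>z. T (f (r n)) z - g z)) \<longlonglongrightarrow> 0))"

text \<open>
  \<open>u\<close> represents \<open>T\<^sup>* y\<close>.  For a bounded operator between Hilbert spaces the Riesz representation
  theorem provides exactly one such vector.
\<close>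

definition adjoint_at ::
  "fun_hilbert \<Rightarrow> fun_hilbert \<Rightarrow> ((complex \<Rightarrow> complex) \<Rightarrow> (complex \<Rightarrow> complex)) \<Rightarrow>
   (complex \<Rightarrow> complex) \<Rightarrow> (complex \<Rightarrow> complex) \<Rightarrow> bool" where
  "adjoint_at H K T y u \<longleftrightarrow> u \<in> vecs H \<and> (\<forall>x \<in> vecs H. ip K (T x) y = ip H x u)"

text \<open>The eigenspace of \<open>T\<^sup>* T\<close> for the eigenvalue \<open>\<sigma>\<^sup>2\<close>.\<close>

definition sing_space ::
  "fun_hilbert \<Rightarrow> fun_hilbert \<Rightarrow> ((complex \<Rightarrow> complex) \<Rightarrow> (complex \<Rightarrow> complex)) \<Rightarrow>
   real \<Rightarrow> (complex \<Rightarrow> complex) set" where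
  "sing_space H K T \<sigma> =
     {e \<in> vecs H. adjoint_at H K T (T e) (\<lambda>z. of_real (\<sigma>\<^sup>2) * e z)}"

text \<open>
  The subspace \<open>E\<close> has the finite dimension \<open>n\<close>: it has an orthonormal basis of \<open>n\<close> elements.
  (The dimension is that of the space of classes, not of the space of representatives.)
\<close>

definition has_hdim :: "fun_hilbert \<Rightarrow> (complex \<Rightarrow> complex) set \<Rightarrow> nat \<Rightarrow> bool" where
  "has_hdim H E n \<longleftrightarrow>
     (\<exists>e :: nat \<Rightarrow> complex \<Rightarrow> complex.
        (\<forall>i<n. e i \<in> E) \<and>
        (\<forall>i<n. \<forall>j<n. ip H (e i) (e j) = (if i = j then 1 else 0)) \<and>
        (\<forall>f \<in> E. hnorm H (\<lambda>z. f z - (\<Sum>i<n. ip H f (e i) * e i z)) = 0))"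

text \<open>
  The singular values of \<open>T\<close> are the eigenvalues of \<open>(T\<^sup>* T)\<^bsup>1/2\<^esup>\<close>, i.e. the square roots of those
  of \<open>T\<^sup>* T\<close>, in decreasing order and repeated according to multiplicity.  As usual the sequence is
  continued by zeros if \<open>T\<close> has finite rank, so the multiplicity of \<open>0\<close> is not recorded.
\<close>

definition singular_values ::
  "fun_hilbert \<Rightarrow> fun_hilbert \<Rightarrow> ((complex \<Rightarrow> complex) \<Rightarrow> (complex \<Rightarrow> complex)) \<Rightarrow>
   (nat \<Rightarrow> real) \<Rightarrow> bool" where
  "singular_values H K T s \<longleftrightarrow>
     decseq s \<and> (\<forall>n. 0 \<le> s n) \<and>
     (\<forall>\<sigma>>0. finite {n. s n = \<sigma>} \<and> has_hdim H (sing_space H K T \<sigma>) (card {n. s n = \<sigma>}))"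

definition schatten_op ::
  "real \<Rightarrow> fun_hilbert \<Rightarrow> fun_hilbert \<Rightarrow> ((complex \<Rightarrow> complex) \<Rightarrow> (complex \<Rightarrow> complex)) \<Rightarrow> bool"
  where
  "schatten_op p H K T \<longleftrightarrow>
     compact_op H K T \<and> (\<exists>s. singular_values H K T s \<and> summable (\<lambda>n. s n powr p))"


section \<open>The weighted Bergman space and L2 spaces\<close>

definition bergman :: "real \<Rightarrow> fun_hilbert" where
  "bergman \<alpha> =
     \<lparr> vecs = {f. f holomorphic_on ball 0 1 \<and>
                  set_integrable lborel (ball 0 1)
                    (\<lambda>z. (cmod (f z))\<^sup>2 * (1 - (cmod z)\<^sup>2) powr \<alpha>)},
       ip = (\<lambda>f g. of_real (1 / pi) *
               (LINT z:ball 0 1|lborel.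
                  f z * cnj (g z) * of_real ((1 - (cmod z)\<^sup>2) powr \<alpha>))) \<rparr>"

definition L2 :: "complex measure \<Rightarrow> fun_hilbert" where
  "L2 M =
     \<lparr> vecs = {f. f \<in> borel_measurable M \<and> integrable M (\<lambda>z. (cmod (f z))\<^sup>2)},
       ip = (\<lambda>f g. LINT z|M. f z * cnj (g z)) \<rparr>"

lemma hnorm_bergman:
  "hnorm (bergman \<alpha>) f =
     sqrt (1 / pi * (LINT z:ball 0 1|lborel. (cmod (f z))\<^sup>2 * (1 - (cmod z)\<^sup>2) powr \<alpha>))"
proof -
  have "ip (bergman \<alpha>) f f = of_real (1 / pi) *
          (LINT z:ball 0 1|lborel. complex_of_real ((cmod (f z))\<^sup>2 * (1 - (cmod z)\<^sup>2) powr \<alpha>))"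
    by (simp only: bergman_def fun_hilbert.simps of_real_mult complex_norm_square)
  also have "\<dots> = of_real (1 / pi *
          (LINT z:ball 0 1|lborel. (cmod (f z))\<^sup>2 * (1 - (cmod z)\<^sup>2) powr \<alpha>))"
    by (subst set_integral_complex_of_real) (rule of_real_mult [symmetric])
  finally show ?thesis
    by (simp only: hnorm_def Re_complex_of_real)
qed

lemma hnorm_L2: "hnorm (L2 M) f = sqrt (LINT z|M. (cmod (f z))\<^sup>2)"
proof -
  have "ip (L2 M) f f = (LINT z|M. complex_of_real ((cmod (f z))\<^sup>2))"
    by (simp only: L2_def fun_hilbert.simps complex_norm_square)
  also have "\<dots> = of_real (LINT z|M. (cmod (f z))\<^sup>2)"
    by (rule integral_complex_of_real)
  finally show ?thesis
    by (simp only: hnorm_def Re_complex_of_real)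
qed


section \<open>Weighted composition operators and the Carleson embedding\<close>

definition weighted_comp ::
  "(complex \<Rightarrow> complex) \<Rightarrow> (complex \<Rightarrow> complex) \<Rightarrow> (complex \<Rightarrow> complex) \<Rightarrow> (complex \<Rightarrow> complex)"
  where
  "weighted_comp h \<phi> f = (\<lambda>z. h z * f (\<phi> z))"

definition finite_borel_cdisc :: "complex measure \<Rightarrow> bool" where
  "finite_borel_cdisc \<mu> \<longleftrightarrow>
     finite_measure \<mu> \<and> sets \<mu> = sets (restrict_space borel (cball 0 1))"

text \<open>
  \<open>J\<close> extends the canonical embedding \<open>I\<^sub>\<mu>\<close>, which is defined on the functions analytic in a
  neighbourhood of the closed disc and sends such a function to itself.
\<close>

definition extends_carleson ::
  "complex measure \<Rightarrow> ((complex \<Rightarrow> complex) \<Rightarrow> (complex \<Rightarrow> complex)) \<Rightarrow> bool" where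
  "extends_carleson \<mu> J \<longleftrightarrow>
     (\<forall>f. f analytic_on cball 0 1 \<longrightarrow> (AE z in \<mu>. J f z = f z))"

definition carleson_bounded :: "real \<Rightarrow> complex measure \<Rightarrow> bool" where
  "carleson_bounded \<alpha> \<mu> \<longleftrightarrow>
     (\<exists>J. extends_carleson \<mu> J \<and> bounded_op (bergman \<alpha>) (L2 \<mu>) J)"

definition carleson_compact :: "real \<Rightarrow> complex measure \<Rightarrow> bool" where
  "carleson_compact \<alpha> \<mu> \<longleftrightarrow>
     (\<exists>J. extends_carleson \<mu> J \<and> compact_op (bergman \<alpha>) (L2 \<mu>) J)"

definition carleson_schatten :: "real \<Rightarrow> real \<Rightarrow> complex measure \<Rightarrow> bool" where
  "carleson_schatten p \<alpha> \<mu> \<longleftrightarrow>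
     (\<exists>J. extends_carleson \<mu> J \<and> schatten_op p (bergman \<alpha>) (L2 \<mu>) J)"

end

(*
  The measure mu is the image under phi of |h|^2 (1-|z|^2)^alpha dA / pi, so ||W f|| = ||f||_{L2(mu)}
  is a change of variables.  For the equivalences one shows that every bounded extension J of the
  Carleson embedding satisfies J f = f mu-almost everywhere for all f in the Bergman space: the Taylor
  polynomials of f converge to f in norm, by a Parseval identity for the radial weight, and pointwise,
  so Fatou's lemma identifies J f.  Hence <J f, J g> = <W f, W g>, and J and W have the same
  boundedness, compactness and singular values.
*)
theory Submission
  imports Defs "HOL-Complex_Analysis.Great_Picard"
begin

section \<open>Rotation invariance and orthogonality of monomials\<close>

text \<open>Two obstacles keep the equivalences from following formally from the norm identity.
  First, on functions that are not analytic on the closed disc an extension \<open>J\<close> is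
  known only through its boundedness, so polynomials must be dense and norm limits must be
  controlled pointwise. Second, \<open>J\<close> and \<open>W\<close> have different target spaces.
  Boundedness and singular values see only the numbers <T f, T g>, but compactness asks for a limit
  in the target, which a norm identity cannot move from \<open>L2 \<mu>\<close> into the Bergman
  space; this is what brings in Montel's theorem and a local bound on point values.

  Parseval is obtained without polar coordinates: a rotation by u multiplies the integral of z^n
  cnj(z^m) by u^n cnj(u)^m, so for n and m distinct the integral vanishes once area measure is
  rotation invariant, and rotation invariance comes from translation invariance through shears. The
  identity lives in the extended nonnegative reals, where it also decides which functions belong to
  the space.\<close>

lemma distr_Complex_lborel:
  "distr (lborel \<Otimes>\<^sub>M lborel) borel (\<lambda>(x, y). Complex x y) = lborel"
proof (rule lborel_eqI [symmetric])
  have [measurable]: "(\<lambda>(x, y). Complex x y) \<in> borel_measurable (lborel \<Otimes>\<^sub>M lborel)"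
    unfolding Complex_eq by measurable
  fix l u :: complex
  assume "\<And>b. b \<in> Basis \<Longrightarrow> l \<bullet> b \<le> u \<bullet> b"
  from this [of 1] this [of \<i>] have le: "Re l \<le> Re u" "Im l \<le> Im u"
    by (auto simp: Basis_complex_def)
  have "(\<lambda>(x, y). Complex x y) -` box l u \<inter> space (lborel \<Otimes>\<^sub>M lborel)
      = box (Re l) (Re u) \<times> box (Im l) (Im u)"
    by (auto simp: box_def Basis_complex_def space_pair_measure)
  then show "emeasure (distr (lborel \<Otimes>\<^sub>M lborel) borel (\<lambda>(x, y). Complex x y)) (box l u)
      = (\<Prod>b\<in>Basis. (u - l) \<bullet> b)"
    using le
    by (simp add: emeasure_distr lborel.emeasure_pair_measure_Times Basis_complex_def ennreal_mult)
qed simp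

lemma nn_integral_lborel_complex:
  fixes f :: "complex \<Rightarrow> ennreal"
  assumes [measurable]: "f \<in> borel_measurable borel"
  shows "(\<integral>\<^sup>+z. f z \<partial>lborel) = (\<integral>\<^sup>+p. f (Complex (fst p) (snd p)) \<partial>(lborel \<Otimes>\<^sub>M lborel))"
proof -
  have [measurable]: "(\<lambda>(x, y). Complex x y) \<in> borel_measurable (lborel \<Otimes>\<^sub>M lborel)"
    unfolding Complex_eq by measurable
  show ?thesis
    by (subst distr_Complex_lborel [symmetric], subst nn_integral_distr)
      (simp_all add: case_prod_beta)
qed

text \<open>By Tonelli the variable that moves can be integrated first; with the other one fixed,
  the shear is a translation of the line.\<close>

lemma nn_integral_shear:
  fixes f :: "real \<times> real \<Rightarrow> ennreal"
  assumes [measurable]: "f \<in> borel_measurable (lborel \<Otimes>\<^sub>M lborel)"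
  shows nn_integral_shear_fst:
      "(\<integral>\<^sup>+p. f (fst p + t * snd p, snd p) \<partial>(lborel \<Otimes>\<^sub>M lborel)) = (\<integral>\<^sup>+p. f p \<partial>(lborel \<Otimes>\<^sub>M lborel))"
    and nn_integral_shear_snd:
      "(\<integral>\<^sup>+p. f (fst p, snd p + t * fst p) \<partial>(lborel \<Otimes>\<^sub>M lborel)) = (\<integral>\<^sup>+p. f p \<partial>(lborel \<Otimes>\<^sub>M lborel))"
proof -
  have translate: "(\<integral>\<^sup>+x. g (x + c) \<partial>lborel) = (\<integral>\<^sup>+x. g x \<partial>lborel)"
    if "g \<in> borel_measurable borel" for g :: "real \<Rightarrow> ennreal" and c
    using nn_integral_real_affine [of g 1 c] that by (simp add: add.commute)
  have "(\<integral>\<^sup>+y. \<integral>\<^sup>+x. f (x + t * y, y) \<partial>lborel \<partial>lborel) = (\<integral>\<^sup>+y. \<integral>\<^sup>+x. f (x, y) \<partial>lborel \<partial>lborel)"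
    by (intro nn_integral_cong translate) measurable
  then show "(\<integral>\<^sup>+p. f (fst p + t * snd p, snd p) \<partial>(lborel \<Otimes>\<^sub>M lborel)) = (\<integral>\<^sup>+p. f p \<partial>(lborel \<Otimes>\<^sub>M lborel))"
    by (simp add: lborel_pair.nn_integral_snd [symmetric])
  have "(\<integral>\<^sup>+x. \<integral>\<^sup>+y. f (x, y + t * x) \<partial>lborel \<partial>lborel) = (\<integral>\<^sup>+x. \<integral>\<^sup>+y. f (x, y) \<partial>lborel \<partial>lborel)"
    by (intro nn_integral_cong translate) measurable
  then show "(\<integral>\<^sup>+p. f (fst p, snd p + t * fst p) \<partial>(lborel \<Otimes>\<^sub>M lborel)) = (\<integral>\<^sup>+p. f p \<partial>(lborel \<Otimes>\<^sub>M lborel))"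
    by (simp add: lborel.nn_integral_fst [symmetric])
qed

text \<open>
  A rotation by an angle \<open>\<theta> \<noteq> \<pi>\<close> is a product of three shears, with coefficients
  \<open>-tan (\<theta>/2)\<close>, \<open>sin \<theta>\<close> and \<open>-tan (\<theta>/2)\<close>.
\<close>

lemma nn_integral_lborel_rotate:
  fixes f :: "complex \<Rightarrow> ennreal"
  assumes [measurable]: "f \<in> borel_measurable borel" and u: "cmod u = 1" "u \<noteq> -1"
  shows "(\<integral>\<^sup>+z. f (u * z) \<partial>lborel) = (\<integral>\<^sup>+z. f z \<partial>lborel)"
proof -
  have sq: "(Re u)\<^sup>2 + (Im u)\<^sup>2 = 1"
    using u(1) by (metis cmod_power2 power_one)
  have ne: "1 + Re u \<noteq> 0"
  proof
    assume "1 + Re u = 0"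
    then have "Re u = -1" by simp
    with sq have "Im u = 0" by simp
    with \<open>Re u = -1\<close> u(2) show False by (simp add: complex_eq_iff)
  qed
  \<comment> \<open>By the half-angle formula sin/(1 + cos) this is -tan(theta/2) for u = e^(i
    theta); the denominator is where \<open>u \<noteq> -1\<close> enters.\<close>
  define t where "t = - (Im u / (1 + Re u))"
  define g where "g = (\<lambda>p. f (Complex (fst p) (snd p)))"
  have tRe: "1 + t * Im u = Re u"
    using ne sq by (simp add: t_def field_simps power2_eq_square)
  have tIm: "t * (1 + Re u) = - Im u"
    using ne by (simp add: t_def)
  have [measurable]: "g \<in> borel_measurable (lborel \<Otimes>\<^sub>M lborel)"
    unfolding g_def Complex_eq by measurable
  \<comment> \<open>The shears are peeled off from the outside: \<open>g1\<close> contains the last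
    one to act, \<open>g2\<close> the last two, and \<open>rot\<close> supplies the first.\<close>
  define g1 where "g1 = (\<lambda>p. g (fst p + t * snd p, snd p))"
  define g2 where "g2 = (\<lambda>p. g1 (fst p, snd p + Im u * fst p))"
  have [measurable]: "g1 \<in> borel_measurable (lborel \<Otimes>\<^sub>M lborel)"
    unfolding g1_def by measurable
  have [measurable]: "g2 \<in> borel_measurable (lborel \<Otimes>\<^sub>M lborel)"
    unfolding g2_def by measurable
  have rot: "f (u * Complex x y) = g2 (x + t * y, y)" for x y
  proof -
    have im: "y + Im u * (x + t * y) = Im u * x + Re u * y"
      using tRe by (simp flip: tRe add: algebra_simps)
    have "x + t * y + t * (Im u * x + Re u * y) = (1 + t * Im u) * x + (t * (1 + Re u)) * y"
      by (simp add: algebra_simps)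
    also have "\<dots> = Re u * x - Im u * y"
      by (simp add: tRe tIm)
    finally have re: "x + t * y + t * (Im u * x + Re u * y) = Re u * x - Im u * y" .
    have "u * Complex x y = Complex (Re u * x - Im u * y) (Im u * x + Re u * y)"
      by (simp add: complex_eq_iff)
    then show ?thesis
      by (simp add: g2_def g1_def g_def im re)
  qed
  have "(\<integral>\<^sup>+z. f (u * z) \<partial>lborel) = (\<integral>\<^sup>+p. f (u * Complex (fst p) (snd p)) \<partial>(lborel \<Otimes>\<^sub>M lborel))"
    by (subst nn_integral_lborel_complex) simp_all
  also have "\<dots> = (\<integral>\<^sup>+p. g2 (fst p + t * snd p, snd p) \<partial>(lborel \<Otimes>\<^sub>M lborel))"
    by (simp add: rot)
  also have "\<dots> = (\<integral>\<^sup>+p. g2 p \<partial>(lborel \<Otimes>\<^sub>M lborel))"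
    by (rule nn_integral_shear_fst) measurable
  also have "\<dots> = (\<integral>\<^sup>+p. g1 p \<partial>(lborel \<Otimes>\<^sub>M lborel))"
    unfolding g2_def by (rule nn_integral_shear_snd) measurable
  also have "\<dots> = (\<integral>\<^sup>+p. g p \<partial>(lborel \<Otimes>\<^sub>M lborel))"
    unfolding g1_def by (rule nn_integral_shear_fst) measurable
  also have "\<dots> = (\<integral>\<^sup>+z. f z \<partial>lborel)"
    unfolding g_def by (rule nn_integral_lborel_complex [symmetric]) simp
  finally show ?thesis .
qed

text \<open>The half turn is left out because the factorisation into shears breaks down there. The
  orthogonality argument is free to choose its rotation and can avoid it.\<close>

definition rotation_invariant :: "complex measure \<Rightarrow> bool" where
  "rotation_invariant M \<longleftrightarrow> (\<forall>u. cmod u = 1 \<longrightarrow> u \<noteq> -1 \<longrightarrow> distr M M ((*) u) = M)"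

lemma continuous_on_unit_disc_measurable:
  assumes "sets M = sets (restrict_space borel (ball 0 (1::real)))"
    and "continuous_on (ball 0 1) f"
  shows "f \<in> borel_measurable M"
  using borel_measurable_continuous_on_restrict [OF assms(2)] measurable_cong_sets [OF assms(1) refl]
  by blast

text \<open>Substituting u z for z multiplies the integral by u^n cnj(u)^m without changing it, so
  it is 0 as soon as some admissible u makes this factor different from 1.\<close>

lemma rotation_invariant_orthogonal:
  assumes sets: "sets M = sets (restrict_space borel (ball 0 1))"
    and rot: "rotation_invariant M" and "m \<noteq> n"
  shows "(LINT z|M. z ^ n * cnj (z ^ m)) = 0"
proof -
  define d where "d = (if n > m then n - m else m - n)"
  have d: "d > 0" using \<open>m \<noteq> n\<close> by (auto simp: d_def)
  \<comment> \<open>Chosen so that \<open>u ^ d\<close> is a quarter turn and the factor is i or -i.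
    Asking for \<open>u ^ d = -1\<close> would lead to the excluded \<open>u = -1\<close> when
    \<open>d = 1\<close>, whereas no power of -1 equals i.\<close>
  define u where "u = cis (pi / (2 * d))"
  have "u ^ d = \<i>"
    using d by (simp add: u_def Complex.DeMoivre)
  have "cnj u * u = 1"
    by (simp add: u_def cis_cnj cis_mult)
  then have cu: "cnj u ^ k * u ^ k = 1" for k
    by (simp flip: power_mult_distrib)
  have ne: "u ^ n * cnj u ^ m \<noteq> 1"
  proof (cases "n > m")
    case True
    then have "u ^ n = u ^ d * u ^ m" by (simp add: d_def flip: power_add)
    then have "u ^ n * cnj u ^ m = \<i>"
      using cu [of m] \<open>u ^ d = \<i>\<close> by (simp add: ac_simps)
    then show ?thesis by simp
  next
    case False
    then have "cnj u ^ m = cnj u ^ d * cnj u ^ n"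
      using \<open>m \<noteq> n\<close> by (simp add: d_def flip: power_add)
    moreover have "cnj u ^ d = - \<i>"
      using \<open>u ^ d = \<i>\<close> by (metis complex_cnj_i complex_cnj_power)
    ultimately have "u ^ n * cnj u ^ m = - \<i>"
      using cu [of n] by (simp add: ac_simps)
    then show ?thesis by (simp add: complex_eq_iff)
  qed
  have "u \<noteq> -1"
  proof
    assume "u = -1"
    with \<open>u ^ d = \<i>\<close> show False by (cases "even d") (auto simp: complex_eq_iff)
  qed
  then have inv: "distr M M ((*) u) = M"
    using rot by (simp add: rotation_invariant_def u_def)
  have sp: "space M = ball 0 1"
    using sets_eq_imp_space_eq [OF sets] by (simp add: space_restrict_space)
  have [measurable]: "(*) u \<in> measurable M M"
  proof -
    have "(*) u \<in> borel_measurable M"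
      by (rule continuous_on_unit_disc_measurable [OF sets]) (intro continuous_intros)
    then have "(*) u \<in> measurable M (restrict_space borel (ball 0 1))"
      by (rule measurable_restrict_space2 [rotated]) (auto simp: sp norm_mult u_def)
    then show ?thesis
      using measurable_cong_sets [OF refl sets] by blast
  qed
  have [measurable]: "(\<lambda>z. z ^ n * cnj (z ^ m)) \<in> borel_measurable M"
    by (rule continuous_on_unit_disc_measurable [OF sets]) (intro continuous_intros)
  have "(LINT z|M. z ^ n * cnj (z ^ m)) = (LINT z|distr M M ((*) u). z ^ n * cnj (z ^ m))"
    by (simp only: inv)
  also have "\<dots> = (LINT z|M. (u * z) ^ n * cnj ((u * z) ^ m))"
    by (rule integral_distr) measurable
  also have "\<dots> = (LINT z|M. (u ^ n * cnj u ^ m) * (z ^ n * cnj (z ^ m)))"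
    by (simp add: power_mult_distrib ac_simps)
  also have "\<dots> = (u ^ n * cnj u ^ m) * (LINT z|M. z ^ n * cnj (z ^ m))"
    by (rule integral_mult_right_zero)
  finally show ?thesis
    using ne by (metis mult_cancel_right1)
qed

text \<open>Finite mass makes all products of monomials integrable, so orthogonality leaves only the
  diagonal for partial sums. Staying at distance from the unit circle bounds all partial sums by one
  constant, and dominated convergence passes to \<open>f\<close>.\<close>

lemma parseval_compact_support:
  assumes sets: "sets M = sets (restrict_space borel (ball 0 1))"
    and rot: "rotation_invariant M" and fin: "finite_measure M"
    and R: "R < 1" "AE z in M. cmod z \<le> R"
    and f: "\<And>z. z \<in> ball 0 1 \<Longrightarrow> (\<lambda>n. a n * z ^ n) sums f z"
  shows "(\<integral>\<^sup>+z. ennreal ((cmod (f z))\<^sup>2) \<partial>M)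
    = (\<Sum>n. ennreal ((cmod (a n))\<^sup>2) * (\<integral>\<^sup>+z. ennreal (cmod z ^ (2 * n)) \<partial>M))"
proof -
  interpret finite_measure M by (rule fin)
  have sp: "space M = ball 0 1"
    using sets_eq_imp_space_eq [OF sets] by (simp add: space_restrict_space)
  define S where "S N z = (\<Sum>n<N. a n * z ^ n)" for N and z :: complex
  define b where "b n = (LINT z|M. cmod z ^ (2 * n))" for n
  have cont [measurable]: "g \<in> borel_measurable M" if "continuous_on UNIV g"
    for g :: "complex \<Rightarrow> 'b::topological_space"
    by (rule continuous_on_unit_disc_measurable [OF sets]) (rule continuous_on_subset [OF that], simp)
  have [measurable]: "S N \<in> borel_measurable M" for N
    unfolding S_def by (intro cont continuous_intros)
  have S_lim: "(\<lambda>N. S N z) \<longlonglongrightarrow> f z" if "z \<in> ball 0 1" for z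
    using f [OF that] by (simp add: sums_def S_def)
  have [measurable]: "f \<in> borel_measurable M"
    by (rule borel_measurable_LIMSEQ_metric [of S]) (auto simp: sp intro: S_lim)
  have int_pow: "integrable M (\<lambda>z. z ^ n * cnj (z ^ m))" for n m
    by (rule integrable_const_bound [where B = 1])
      (auto intro!: cont continuous_intros AE_I2 simp: sp norm_mult norm_power mult_le_one power_le_one)
  have diag: "(LINT z|M. z ^ n * cnj (z ^ n)) = of_real (b n)" for n
  proof -
    have "z ^ n * cnj (z ^ n) = complex_of_real (cmod z ^ (2 * n))" for z
      by (metis complex_norm_square norm_power of_real_power power_even_eq)
    then show ?thesis by (simp add: b_def flip: integral_complex_of_real)
  qed
  have S_int: "(LINT z|M. (cmod (S N z))\<^sup>2) = (\<Sum>n<N. (cmod (a n))\<^sup>2 * b n)" for N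
  proof -
    have "complex_of_real (LINT z|M. (cmod (S N z))\<^sup>2) = (LINT z|M. S N z * cnj (S N z))"
      by (simp only: complex_norm_square flip: integral_complex_of_real)
    also have "\<dots> = (LINT z|M. (\<Sum>n<N. \<Sum>m<N. (a n * cnj (a m)) * (z ^ n * cnj (z ^ m))))"
      by (simp add: S_def sum_product ac_simps)
    also have "\<dots> = (\<Sum>n<N. \<Sum>m<N. (a n * cnj (a m)) * (LINT z|M. z ^ n * cnj (z ^ m)))"
      using int_pow by (simp add: Bochner_Integration.integral_sum del: complex_cnj_power)
    also have "\<dots> = (\<Sum>n<N. \<Sum>m<N. if m = n then a n * cnj (a n) * of_real (b n) else 0)"
      by (intro sum.cong refl)
        (auto simp: diag rotation_invariant_orthogonal [OF sets rot] simp del: complex_cnj_power)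
    also have "\<dots> = of_real (\<Sum>n<N. (cmod (a n))\<^sup>2 * b n)"
      unfolding of_real_sum of_real_mult complex_norm_square by simp
    finally show ?thesis by (simp only: of_real_eq_iff)
  qed
  \<comment> \<open>\<open>R\<close> may be negative (then \<open>M\<close> has no mass), but a
    radius of convergence argument wants a nonnegative number.\<close>
  define R' where "R' = max R 0"
  have R': "0 \<le> R'" "R' < 1" "AE z in M. cmod z \<le> R'"
    using R by (auto simp: R'_def)
  have summ: "summable (\<lambda>n. cmod (a n) * R' ^ n)"
  proof -
    \<comment> \<open>A point strictly between \<open>R'\<close> and 1: convergence of the series at
      \<open>s\<close> gives absolute convergence at the smaller radius \<open>R'\<close>.\<close>
    define s where "s = (1 + R') / 2"
    have "s \<in> {0..<1}" "R' < s" using R' by (auto simp: s_def)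
    then have "summable (\<lambda>n. a n * of_real s ^ n)"
      using f [of "of_real s"] by (auto simp: sums_iff)
    then have "summable (\<lambda>n. norm (a n * of_real R' ^ n))"
      by (rule powser_insidea) (use \<open>R' < s\<close> R' in auto)
    then show ?thesis using R' by (simp add: norm_mult norm_power)
  qed
  define C where "C = (\<Sum>n. cmod (a n) * R' ^ n)"
  have S_le: "cmod (S N z) \<le> C" if "cmod z \<le> R'" for N z
  proof -
    have "cmod (S N z) \<le> (\<Sum>n<N. cmod (a n) * R' ^ n)"
      unfolding S_def using that R'(1)
      by (intro sum_norm_le) (auto simp: norm_mult norm_power intro!: mult_left_mono power_mono)
    also have "\<dots> \<le> C"
      unfolding C_def by (rule sum_le_suminf [OF summ]) (use R' in auto)
    finally show ?thesis .
  qed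
  have bound: "AE z in M. norm ((cmod (S N z))\<^sup>2) \<le> C\<^sup>2" for N
    using R'(3) by eventually_elim (auto intro!: power_mono S_le)
  have lim: "AE z in M. (\<lambda>N. (cmod (S N z))\<^sup>2) \<longlonglongrightarrow> (cmod (f z))\<^sup>2"
    by (rule AE_I2) (auto simp: sp intro!: tendsto_intros S_lim)
  have "(\<lambda>N. LINT z|M. (cmod (S N z))\<^sup>2) \<longlonglongrightarrow> (LINT z|M. (cmod (f z))\<^sup>2)"
    by (rule integral_dominated_convergence [where w = "\<lambda>_. C\<^sup>2"]) (use lim bound in auto)
  then have sums: "(\<lambda>n. (cmod (a n))\<^sup>2 * b n) sums (LINT z|M. (cmod (f z))\<^sup>2)"
    by (simp add: sums_def S_int)
  have "integrable M (\<lambda>z. (cmod (f z))\<^sup>2)"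
    by (rule integrable_dominated_convergence [where w = "\<lambda>_. C\<^sup>2", OF _ _ _ lim bound]) auto
  then have f_eq: "(\<integral>\<^sup>+z. ennreal ((cmod (f z))\<^sup>2) \<partial>M) = ennreal (LINT z|M. (cmod (f z))\<^sup>2)"
    by (rule nn_integral_eq_integral) simp
  have b_nonneg: "b n \<ge> 0" for n by (simp add: b_def)
  have "integrable M (\<lambda>z. cmod z ^ (2 * n))" for n
    by (rule integrable_const_bound [where B = 1])
      (auto intro!: cont continuous_intros AE_I2 simp: sp power_le_one)
  then have b_eq: "(\<integral>\<^sup>+z. ennreal (cmod z ^ (2 * n)) \<partial>M) = ennreal (b n)" for n
    unfolding b_def by (rule nn_integral_eq_integral) simp
  have "(\<Sum>n. ennreal ((cmod (a n))\<^sup>2 * b n)) = ennreal (LINT z|M. (cmod (f z))\<^sup>2)"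
    by (rule suminf_ennreal_eq [OF _ sums]) (simp add: b_nonneg)
  then show ?thesis
    unfolding f_eq b_eq by (subst ennreal_mult [symmetric]) (auto simp: b_nonneg)
qed

section \<open>Parseval identity for radial weights\<close>

text \<open>The weight is kept general so that its truncations to smaller discs are again weights of
  the same kind.\<close>

definition radial_measure :: "(real \<Rightarrow> real) \<Rightarrow> complex measure" where
  "radial_measure g = density (restrict_space lborel (ball 0 1)) (\<lambda>z. ennreal (g (cmod z)))"

lemma sets_radial_measure: "sets (radial_measure g) = sets (restrict_space borel (ball 0 1))"
  by (simp add: radial_measure_def cong: sets_restrict_space_cong)

lemma space_radial_measure [simp]: "space (radial_measure g) = ball 0 1"
  by (simp add: radial_measure_def space_restrict_space)

lemma measurable_radial_measure:
  "continuous_on (ball 0 1) f \<Longrightarrow> f \<in> borel_measurable (radial_measure g)"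
  by (rule continuous_on_unit_disc_measurable [OF sets_radial_measure])

lemma borel_measurable_radial_measure_iff:
  "f \<in> borel_measurable (radial_measure g) \<longleftrightarrow>
   f \<in> borel_measurable (restrict_space lborel (ball 0 1))"
  by (rule arg_cong2 [where f = "(\<in>)"]) (simp_all add: radial_measure_def measurable_def)

lemma measurable_radial_weight:
  assumes "g \<in> borel_measurable borel"
  shows "(\<lambda>z. g (cmod z)) \<in> borel_measurable (restrict_space lborel (ball 0 1))"
  using assms by (intro measurable_restrict_space1) simp

lemma nn_integral_radial_measure:
  assumes [measurable]: "g \<in> borel_measurable borel"
    and "f \<in> borel_measurable (radial_measure g)"
  shows "(\<integral>\<^sup>+z. f z \<partial>radial_measure g)
    = (\<integral>\<^sup>+z. ennreal (g (cmod z)) * f z \<partial>restrict_space lborel (ball 0 1))"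
  unfolding radial_measure_def
  using assms measurable_radial_weight [OF assms(1)]
  by (intro nn_integral_density) (auto simp: borel_measurable_radial_measure_iff)

lemma rotation_invariant_radial_measure:
  assumes g [measurable]: "g \<in> borel_measurable borel"
  shows "rotation_invariant (radial_measure g)"
  unfolding rotation_invariant_def
proof (intro allI impI)
  fix u :: complex
  assume u: "cmod u = 1" "u \<noteq> -1"
  let ?M = "radial_measure g"
  have ball: "u * z \<in> ball 0 1 \<longleftrightarrow> z \<in> ball 0 1" for z
    using u by (simp add: norm_mult)
  have "(*) u \<in> borel_measurable ?M"
    by (rule measurable_radial_measure) (intro continuous_intros)
  then have "(*) u \<in> measurable ?M (restrict_space borel (ball 0 1))"
    by (rule measurable_restrict_space2 [rotated]) (use ball in auto)
  then have mu: "(*) u \<in> measurable ?M ?M"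
    using measurable_cong_sets [OF refl sets_radial_measure] by blast
  show "distr ?M ?M ((*) u) = ?M"
  proof (rule measure_eqI)
    fix E assume "E \<in> sets (distr ?M ?M ((*) u))"
    then have E: "E \<in> sets ?M" by simp
    then have [measurable]: "E \<in> sets borel" and "E \<subseteq> ball 0 1"
      by (auto simp: sets_radial_measure sets_restrict_space)
    \<comment> \<open>Measures of sets in the disc become integrals over the whole plane, where the
      rotation lemma for \<open>lborel\<close> applies; the indicator of \<open>D\<close> already
      confines them to the disc.\<close>
    have em: "emeasure ?M D = (\<integral>\<^sup>+z. ennreal (g (cmod z)) * indicator D z \<partial>lborel)"
      if D: "D \<in> sets ?M" for D
    proof -
      have "D \<in> sets borel" "D \<subseteq> ball 0 1"
        using D by (auto simp: sets_radial_measure sets_restrict_space)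
      have "emeasure ?M D = (\<integral>\<^sup>+z. indicator D z \<partial>?M)"
        using D by simp
      also have "\<dots> = (\<integral>\<^sup>+z. ennreal (g (cmod z)) * indicator D z * indicator (ball 0 1) z \<partial>lborel)"
        using D by (subst nn_integral_radial_measure) (auto simp: nn_integral_restrict_space)
      also have "\<dots> = (\<integral>\<^sup>+z. ennreal (g (cmod z)) * indicator D z \<partial>lborel)"
        using \<open>D \<subseteq> ball 0 1\<close> by (intro nn_integral_cong) (auto split: split_indicator)
      finally show ?thesis .
    qed
    define D where "D = (*) u -` E \<inter> ball 0 1"
    have D: "D \<in> sets ?M"
      using measurable_sets [OF mu E] by (simp add: D_def)
    have "emeasure (distr ?M ?M ((*) u)) E = emeasure ?M D"
      using emeasure_distr [OF mu E] by (simp add: D_def)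
    also have "\<dots> = (\<integral>\<^sup>+z. ennreal (g (cmod (u * z))) * indicator E (u * z) \<partial>lborel)"
      unfolding em [OF D] using ball \<open>E \<subseteq> ball 0 1\<close> u
      by (intro nn_integral_cong) (auto simp: D_def norm_mult split: split_indicator)
    also have "\<dots> = (\<integral>\<^sup>+z. ennreal (g (cmod z)) * indicator E z \<partial>lborel)"
      by (rule nn_integral_lborel_rotate [OF _ u]) measurable
    also have "\<dots> = emeasure ?M E"
      by (rule em [OF E, symmetric])
    finally show "emeasure (distr ?M ?M ((*) u)) E = emeasure ?M E" .
  qed simp
qed

lemma nn_integral_radial_exhaustion:
  fixes R :: "nat \<Rightarrow> real"
  assumes [measurable]: "g \<in> borel_measurable borel"
    and f: "f \<in> borel_measurable (radial_measure g)"
    and R: "incseq R" "R \<longlonglongrightarrow> 1"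
  shows "(SUP k. \<integral>\<^sup>+z. f z \<partial>radial_measure (\<lambda>r. g r * indicator {..R k} r))
    = (\<integral>\<^sup>+z. f z \<partial>radial_measure g)"
proof -
  let ?L = "restrict_space lborel (ball (0::complex) 1)"
  let ?F = "\<lambda>k z. ennreal (g (cmod z) * indicator {..R k} (cmod z)) * f z"
  have [measurable]: "f \<in> borel_measurable ?L"
    using f by (simp add: borel_measurable_radial_measure_iff)
  have [measurable]: "(\<lambda>z. g (cmod z) * indicator {..R k} (cmod z)) \<in> borel_measurable ?L" for k
    by (rule measurable_radial_weight) measurable
  have inc: "incseq ?F"
  proof (intro incseq_SucI le_funI)
    fix k z
    have "indicator {..R k} (cmod z) \<le> (indicator {..R (Suc k)} (cmod z) :: real)"
      using incseq_SucD [OF R(1), of k] by (auto split: split_indicator)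
    \<comment> \<open>Where \<open>g\<close> is negative the truncated weight is not increasing in k
      as a real number, but \<open>ennreal\<close> sends it to 0 for every k.\<close>
    then have "ennreal (g (cmod z) * indicator {..R k} (cmod z))
      \<le> ennreal (g (cmod z) * indicator {..R (Suc k)} (cmod z))"
      by (cases "g (cmod z) \<ge> 0")
        (auto intro!: ennreal_leI mult_left_mono simp: ennreal_neg mult_nonpos_nonneg)
    then show "?F k z \<le> ?F (Suc k) z" by (intro mult_right_mono) auto
  qed
  have sup: "(SUP k. ?F k z) = ennreal (g (cmod z)) * f z" if "z \<in> space ?L" for z
  proof -
    have "cmod z < 1" using that by (simp add: space_restrict_space)
    then have "eventually (\<lambda>k. cmod z < R k) sequentially"
      using order_tendstoD(1) [OF R(2)] by blast
    then have "eventually (\<lambda>k. ?F k z = ennreal (g (cmod z)) * f z) sequentially"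
      by eventually_elim auto
    then have "(\<lambda>k. ?F k z) \<longlonglongrightarrow> ennreal (g (cmod z)) * f z"
      by (rule tendsto_eventually)
    moreover have "(\<lambda>k. ?F k z) \<longlonglongrightarrow> (SUP k. ?F k z)"
      using inc by (intro LIMSEQ_SUP) (auto simp: incseq_def le_fun_def)
    ultimately show ?thesis by (rule LIMSEQ_unique [symmetric])
  qed
  have "(\<integral>\<^sup>+z. f z \<partial>radial_measure (\<lambda>r. g r * indicator {..R k} r)) = (\<integral>\<^sup>+z. ?F k z \<partial>?L)" for k
    using f by (intro nn_integral_radial_measure)
      (simp_all add: borel_measurable_radial_measure_iff)
  then have "(SUP k. \<integral>\<^sup>+z. f z \<partial>radial_measure (\<lambda>r. g r * indicator {..R k} r))
    = (SUP k. \<integral>\<^sup>+z. ?F k z \<partial>?L)"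
    by simp
  also have "\<dots> = (\<integral>\<^sup>+z. (SUP k. ?F k z) \<partial>?L)"
    by (intro nn_integral_monotone_convergence_SUP [symmetric] inc) measurable
  also have "\<dots> = (\<integral>\<^sup>+z. ennreal (g (cmod z)) * f z \<partial>?L)"
    by (intro nn_integral_cong sup)
  also have "\<dots> = (\<integral>\<^sup>+z. f z \<partial>radial_measure g)"
    by (rule nn_integral_radial_measure [symmetric, OF _ f]) simp
  finally show ?thesis .
qed

lemma power_series_measurable_radial:
  assumes "\<And>z. z \<in> ball 0 1 \<Longrightarrow> (\<lambda>n. a n * z ^ n) sums f z"
  shows "f \<in> borel_measurable (radial_measure g)"
proof (rule measurable_radial_measure)
  show "continuous_on (ball 0 1) f"
    using power_series_holomorphic [of 0 1 a f] assms
    by (intro holomorphic_on_imp_continuous_on) simp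
qed

text \<open>Continuity bounds \<open>g\<close> on each \<open>{0..R k}\<close>, so the weight cut
  off at radius \<open>R k\<close> gives a finite measure to which the compactly supported case
  applies. Both sides increase with k, and monotone convergence, for the integral and for the
  series, removes the cut-off.\<close>

lemma parseval_radial:
  assumes g [measurable]: "g \<in> borel_measurable borel"
    and cont: "continuous_on {0..<1} g"
    and f: "\<And>z. z \<in> ball 0 1 \<Longrightarrow> (\<lambda>n. a n * z ^ n) sums f z"
  shows "(\<integral>\<^sup>+z. ennreal ((cmod (f z))\<^sup>2) \<partial>radial_measure g)
    = (\<Sum>n. ennreal ((cmod (a n))\<^sup>2) * (\<integral>\<^sup>+z. ennreal (cmod z ^ (2 * n)) \<partial>radial_measure g))"
proof -
  define R :: "nat \<Rightarrow> real" where "R k = 1 - 1 / Suc k" for k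
  have R: "0 \<le> R k" "R k < 1" for k by (auto simp: R_def)
  have incR: "incseq R" by (auto simp: incseq_Suc_iff R_def field_simps)
  have limR: "R \<longlonglongrightarrow> 1"
    unfolding R_def using tendsto_diff [OF tendsto_const LIMSEQ_inverse_real_of_nat, of 1]
    by (simp add: inverse_eq_divide)
  let ?M = "\<lambda>k. radial_measure (\<lambda>r. g r * indicator {..R k} r)"
  have fin: "finite_measure (?M k)" for k
  proof
    have "compact (g ` {0..R k})"
      using R [of k] by (intro compact_continuous_image continuous_on_subset [OF cont]) auto
    then obtain B where B: "\<And>r. r \<in> {0..R k} \<Longrightarrow> \<bar>g r\<bar> \<le> B"
      using compact_imp_bounded bounded_iff by (metis imageI real_norm_def)
    let ?L = "restrict_space lborel (ball (0::complex) 1)"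
    have "emeasure (?M k) (space (?M k)) = (\<integral>\<^sup>+z. 1 \<partial>?M k)"
      by simp
    also have "\<dots> = (\<integral>\<^sup>+z. ennreal (g (cmod z) * indicator {..R k} (cmod z)) \<partial>?L)"
      by (subst nn_integral_radial_measure) auto
    also have "\<dots> \<le> (\<integral>\<^sup>+z. ennreal \<bar>B\<bar> \<partial>?L)"
    proof (intro nn_integral_mono ennreal_leI)
      fix z show "g (cmod z) * indicator {..R k} (cmod z) \<le> \<bar>B\<bar>"
        using B [of "cmod z"] by (auto split: split_indicator)
    qed
    also have "\<dots> = ennreal \<bar>B\<bar> * emeasure lborel (ball (0::complex) 1)"
      by (simp add: emeasure_restrict_space space_restrict_space)
    also have "\<dots> < \<infinity>"
      using emeasure_bounded_finite [OF bounded_ball, of "0::complex" 1] by (simp add: ennreal_mult_less_top)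
    finally show "emeasure (?M k) (space (?M k)) \<noteq> \<infinity>" by simp
  qed
  have supp: "AE z in ?M k. cmod z \<le> R k" for k
  proof -
    have "(\<lambda>z. ennreal (g (cmod z) * indicator {..R k} (cmod z)))
      \<in> borel_measurable (restrict_space lborel (ball (0::complex) 1))"
      by (intro measurable_compose [OF measurable_radial_weight measurable_ennreal]) measurable
    then show ?thesis
      unfolding radial_measure_def by (subst AE_density) (auto split: split_indicator_asm)
  qed
  have meas: "(\<lambda>z. ennreal ((cmod (f z))\<^sup>2)) \<in> borel_measurable (radial_measure g)"
    "(\<lambda>z. ennreal (cmod z ^ (2 * n))) \<in> borel_measurable (radial_measure g)" for n
  proof -
    have [measurable]: "f \<in> borel_measurable (radial_measure g)"
      by (rule power_series_measurable_radial [OF f])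
    show "(\<lambda>z. ennreal ((cmod (f z))\<^sup>2)) \<in> borel_measurable (radial_measure g)" by measurable
    have [measurable]: "cmod \<in> borel_measurable (radial_measure g)"
      by (intro measurable_radial_measure continuous_intros)
    show "(\<lambda>z. ennreal (cmod z ^ (2 * n))) \<in> borel_measurable (radial_measure g)" by measurable
  qed
  let ?c = "\<lambda>k n. \<integral>\<^sup>+z. ennreal (cmod z ^ (2 * n)) \<partial>?M k"
  have incc: "incseq (\<lambda>k. ?c k n)" for n
  proof (rule incseq_SucI)
    fix k
    have m: "(\<lambda>z. ennreal (cmod z ^ (2 * n))) \<in> borel_measurable (?M k)" for k
      using meas(2) by (simp add: borel_measurable_radial_measure_iff)
    show "?c k n \<le> ?c (Suc k) n"
      using m incseq_SucD [OF incR, of k]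
      by (subst (1 2) nn_integral_radial_measure)
        (auto intro!: nn_integral_mono mult_right_mono split: split_indicator)
  qed
  have "(\<integral>\<^sup>+z. ennreal ((cmod (f z))\<^sup>2) \<partial>radial_measure g)
      = (SUP k. \<integral>\<^sup>+z. ennreal ((cmod (f z))\<^sup>2) \<partial>?M k)"
    by (rule nn_integral_radial_exhaustion [symmetric, OF g meas(1) incR limR])
  also have "\<dots> = (SUP k. \<Sum>n. ennreal ((cmod (a n))\<^sup>2) * ?c k n)"
    by (intro SUP_cong refl parseval_compact_support [OF sets_radial_measure _ fin R(2) supp f]
        rotation_invariant_radial_measure) measurable
  also have "\<dots> = (\<Sum>n. SUP k. ennreal ((cmod (a n))\<^sup>2) * ?c k n)"
    by (intro ennreal_suminf_SUP_eq [symmetric])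
      (use incc in \<open>auto simp: incseq_def intro!: mult_left_mono\<close>)
  also have "\<dots> = (\<Sum>n. ennreal ((cmod (a n))\<^sup>2) * (SUP k. ?c k n))"
    by (simp add: SUP_mult_left_ennreal)
  also have "\<dots> = (\<Sum>n. ennreal ((cmod (a n))\<^sup>2) * (\<integral>\<^sup>+z. ennreal (cmod z ^ (2 * n)) \<partial>radial_measure g))"
    by (simp only: nn_integral_radial_exhaustion [OF g meas(2) incR limR])
  finally show ?thesis .
qed

section \<open>The Bergman norm as an \<open>L\<^sup>2\<close> norm\<close>

text \<open>\<open>hnorm\<close> is built on the Bochner integral and gives 0 to a function that is
  not square integrable. This version keeps the value infinity, so membership in \<open>L2 M\<close>
  can be read off from it and Fatou's lemma applies.\<close>

definition nn_sq :: "complex measure \<Rightarrow> (complex \<Rightarrow> complex) \<Rightarrow> ennreal" where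
  "nn_sq M f = (\<integral>\<^sup>+z. ennreal ((cmod (f z))\<^sup>2) \<partial>M)"

lemma vecs_L2_iff:
  "f \<in> vecs (L2 M) \<longleftrightarrow> f \<in> borel_measurable M \<and> nn_sq M f < \<infinity>"
proof (cases "f \<in> borel_measurable M")
  case True
  then have "(\<lambda>z. (cmod (f z))\<^sup>2) \<in> borel_measurable M" by measurable
  then show ?thesis
    using True by (simp add: L2_def nn_sq_def integrable_iff_bounded)
qed (simp add: L2_def)

lemma nn_sq_eq_hnorm:
  assumes "f \<in> vecs (L2 M)"
  shows "nn_sq M f = ennreal ((hnorm (L2 M) f)\<^sup>2)"
  using assms unfolding nn_sq_def hnorm_L2
  by (subst nn_integral_eq_integral) (auto simp: L2_def)

lemma hnorm_L2_nonneg: "0 \<le> hnorm (L2 M) f"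
  by (simp add: hnorm_L2)

lemma L2_lincomb:
  assumes "f \<in> vecs (L2 M)" "g \<in> vecs (L2 M)"
  shows "(\<lambda>z. a * f z + b * g z) \<in> vecs (L2 M)"
proof -
  have [measurable]: "f \<in> borel_measurable M" "g \<in> borel_measurable M"
    and int: "integrable M (\<lambda>z. (cmod (f z))\<^sup>2)" "integrable M (\<lambda>z. (cmod (g z))\<^sup>2)"
    using assms by (auto simp: L2_def)
  have le: "(cmod (a * f z + b * g z))\<^sup>2 \<le> 2 * (cmod a)\<^sup>2 * (cmod (f z))\<^sup>2 + 2 * (cmod b)\<^sup>2 * (cmod (g z))\<^sup>2"
    (is "?l \<le> ?r") for z
  proof -
    have "?l \<le> (cmod (a * f z) + cmod (b * g z))\<^sup>2"
      by (intro power_mono norm_triangle_ineq) simp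
    also have "\<dots> \<le> 2 * (cmod (a * f z))\<^sup>2 + 2 * (cmod (b * g z))\<^sup>2"
      using zero_le_power2 [of "cmod (a * f z) - cmod (b * g z)"]
      unfolding power2_sum power2_diff by linarith
    finally show ?thesis by (simp add: norm_mult power_mult_distrib)
  qed
  have "integrable M (\<lambda>z. 2 * (cmod a)\<^sup>2 * (cmod (f z))\<^sup>2 + 2 * (cmod b)\<^sup>2 * (cmod (g z))\<^sup>2)"
    by (intro Bochner_Integration.integrable_add integrable_mult_right int)
  then have "integrable M (\<lambda>z. (cmod (a * f z + b * g z))\<^sup>2)"
    by (rule Bochner_Integration.integrable_bound) (use le in \<open>auto intro!: AE_I2 order_trans [OF le]\<close>)
  then show ?thesis by (simp add: L2_def)
qed

lemma L2_diff:
  assumes "f \<in> vecs (L2 M)" "g \<in> vecs (L2 M)"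
  shows "(\<lambda>z. f z - g z) \<in> vecs (L2 M)"
  using L2_lincomb [OF assms, of 1 "-1"] by simp

lemma hnorm_L2_cong_AE:
  assumes "AE z in M. f z = g z" "f \<in> borel_measurable M" "g \<in> borel_measurable M"
  shows "hnorm (L2 M) f = hnorm (L2 M) g"
  unfolding hnorm_L2
  by (intro arg_cong [where f = sqrt] integral_cong_AE) (use assms in auto)

lemma hnorm_L2_eq_0_iff:
  assumes "f \<in> vecs (L2 M)"
  shows "hnorm (L2 M) f = 0 \<longleftrightarrow> (AE z in M. f z = 0)"
proof -
  have "hnorm (L2 M) f = 0 \<longleftrightarrow> nn_sq M f = 0"
    by (simp add: nn_sq_eq_hnorm [OF assms])
  also have "\<dots> \<longleftrightarrow> (AE z in M. f z = 0)"
    using assms unfolding nn_sq_def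
    by (subst nn_integral_0_iff_AE) (auto simp: L2_def)
  finally show ?thesis .
qed

lemma fatou_nn_sq:
  assumes [measurable]: "\<And>n. F n \<in> borel_measurable M"
    and "AE z in M. (\<lambda>n. F n z) \<longlonglongrightarrow> f z"
  shows "nn_sq M f \<le> liminf (\<lambda>n. nn_sq M (F n))"
proof -
  have "AE z in M. ennreal ((cmod (f z))\<^sup>2) = liminf (\<lambda>n. ennreal ((cmod (F n z))\<^sup>2))"
    using assms(2)
  proof eventually_elim
    case (elim z)
    then have "(\<lambda>n. ennreal ((cmod (F n z))\<^sup>2)) \<longlonglongrightarrow> ennreal ((cmod (f z))\<^sup>2)"
      by (intro tendsto_intros)
    then show ?case by (intro lim_imp_Liminf [symmetric]) auto
  qed
  then have "nn_sq M f = (\<integral>\<^sup>+z. liminf (\<lambda>n. ennreal ((cmod (F n z))\<^sup>2)) \<partial>M)"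
    unfolding nn_sq_def by (rule nn_integral_cong_AE)
  also have "\<dots> \<le> liminf (\<lambda>n. nn_sq M (F n))"
    unfolding nn_sq_def by (rule nn_integral_liminf) measurable
  finally show ?thesis .
qed

text \<open>Fatou's lemma for F n - g, whose pointwise limit is f - g and whose norms tend to 0.
  This replaces the extraction of an almost everywhere convergent subsequence.\<close>

lemma L2_limit_eq_pointwise_limit:
  assumes F: "\<And>n. F n \<in> vecs (L2 M)" and g: "g \<in> vecs (L2 M)"
    and f: "f \<in> borel_measurable M"
    and lim: "AE z in M. (\<lambda>n. F n z) \<longlonglongrightarrow> f z"
    and norm: "(\<lambda>n. hnorm (L2 M) (\<lambda>z. F n z - g z)) \<longlonglongrightarrow> 0"
  shows "AE z in M. f z = g z"
proof -
  have meas [measurable]: "F n \<in> borel_measurable M" "g \<in> borel_measurable M" for n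
    using F g by (auto simp: L2_def)
  have "nn_sq M (\<lambda>z. f z - g z) \<le> liminf (\<lambda>n. nn_sq M (\<lambda>z. F n z - g z))"
    by (rule fatou_nn_sq) (measurable, use lim in \<open>eventually_elim, auto intro!: tendsto_intros\<close>)
  also have "(\<lambda>n. nn_sq M (\<lambda>z. F n z - g z)) = (\<lambda>n. ennreal ((hnorm (L2 M) (\<lambda>z. F n z - g z))\<^sup>2))"
    by (intro ext nn_sq_eq_hnorm L2_diff F g)
  also have "liminf \<dots> = ennreal (0\<^sup>2)"
    by (intro lim_imp_Liminf tendsto_intros norm) auto
  finally have "nn_sq M (\<lambda>z. f z - g z) = 0" by simp
  then have "AE z in M. ennreal ((cmod (f z - g z))\<^sup>2) = 0"
    unfolding nn_sq_def by (subst (asm) nn_integral_0_iff_AE) (use f in auto)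
  then show ?thesis by eventually_elim simp
qed

section \<open>The normalised weighted area measure of the Bergman space\<close>

definition area_measure :: "real \<Rightarrow> complex measure" where
  "area_measure \<alpha> = radial_measure (\<lambda>r. (1 - r\<^sup>2) powr \<alpha> / pi)"

lemma space_area_measure [simp]: "space (area_measure \<alpha>) = ball 0 1"
  by (simp add: area_measure_def)

lemma measurable_area_measure:
  "continuous_on (ball 0 1) f \<Longrightarrow> f \<in> borel_measurable (area_measure \<alpha>)"
  unfolding area_measure_def by (rule measurable_radial_measure)

lemma holomorphic_measurable_area_measure:
  "f holomorphic_on ball 0 1 \<Longrightarrow> f \<in> borel_measurable (area_measure \<alpha>)"
  by (intro measurable_area_measure holomorphic_on_imp_continuous_on)

lemma bergman_weight_measurable [measurable]:
  "(\<lambda>r::real. (1 - r\<^sup>2) powr \<alpha> / pi) \<in> borel_measurable borel"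
  by measurable

lemma ip_bergman:
  assumes "f \<in> borel_measurable (area_measure \<alpha>)" "g \<in> borel_measurable (area_measure \<alpha>)"
  shows "ip (bergman \<alpha>) f g = ip (L2 (area_measure \<alpha>)) f g"
proof -
  let ?L = "restrict_space lborel (ball (0::complex) 1)"
  have m: "(\<lambda>z. f z * cnj (g z)) \<in> borel_measurable ?L"
  proof -
    have [measurable]: "f \<in> borel_measurable ?L" "g \<in> borel_measurable ?L"
      using assms by (simp_all add: area_measure_def borel_measurable_radial_measure_iff)
    have [measurable]: "cnj \<in> borel_measurable borel"
      by (intro borel_measurable_continuous_onI continuous_intros)
    show ?thesis by measurable
  qed
  have w: "(\<lambda>z. (1 - (cmod z)\<^sup>2) powr \<alpha> / pi) \<in> borel_measurable ?L"
    by (rule measurable_radial_weight) measurable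
  have "ip (L2 (area_measure \<alpha>)) f g
      = (LINT z|?L. ((1 - (cmod z)\<^sup>2) powr \<alpha> / pi) *\<^sub>R (f z * cnj (g z)))"
    unfolding L2_def area_measure_def radial_measure_def fun_hilbert.simps
    using m w by (intro integral_density) auto
  also have "\<dots> = (LINT z|lborel. indicator (ball 0 1) z *\<^sub>R
      (((1 - (cmod z)\<^sup>2) powr \<alpha> / pi) *\<^sub>R (f z * cnj (g z))))"
    by (rule integral_restrict_space) simp
  also have "\<dots> = (LINT z|lborel. of_real (1 / pi) * (indicator (ball 0 1) z *\<^sub>R
      (f z * cnj (g z) * of_real ((1 - (cmod z)\<^sup>2) powr \<alpha>))))"
    by (intro Bochner_Integration.integral_cong refl) (auto simp: scaleR_conv_of_real)
  also have "\<dots> = ip (bergman \<alpha>) f g"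
    unfolding bergman_def set_lebesgue_integral_def fun_hilbert.simps
    by (rule integral_mult_right_zero)
  finally show ?thesis ..
qed

lemma hnorm_bergman_eq_L2:
  "f \<in> borel_measurable (area_measure \<alpha>) \<Longrightarrow> hnorm (bergman \<alpha>) f = hnorm (L2 (area_measure \<alpha>)) f"
  by (simp add: hnorm_def ip_bergman)

lemma vecs_bergman_iff:
  "f \<in> vecs (bergman \<alpha>) \<longleftrightarrow> f holomorphic_on ball 0 1 \<and> f \<in> vecs (L2 (area_measure \<alpha>))"
proof (cases "f holomorphic_on ball 0 1")
  case True
  let ?L = "restrict_space lborel (ball (0::complex) 1)"
  have f: "f \<in> borel_measurable (area_measure \<alpha>)"
    using True by (rule holomorphic_measurable_area_measure)
  then have m: "(\<lambda>z. (cmod (f z))\<^sup>2) \<in> borel_measurable ?L"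
    unfolding area_measure_def borel_measurable_radial_measure_iff by measurable
  have w: "(\<lambda>z. (1 - (cmod z)\<^sup>2) powr \<alpha> / pi) \<in> borel_measurable ?L"
    by (rule measurable_radial_weight) measurable
  have "integrable (area_measure \<alpha>) (\<lambda>z. (cmod (f z))\<^sup>2)
      \<longleftrightarrow> integrable ?L (\<lambda>z. ((1 - (cmod z)\<^sup>2) powr \<alpha> / pi) *\<^sub>R (cmod (f z))\<^sup>2)"
    unfolding area_measure_def radial_measure_def using m w by (intro integrable_density) auto
  also have "\<dots> \<longleftrightarrow> integrable lborel (\<lambda>z. indicator (ball 0 1) z *\<^sub>R
      (((1 - (cmod z)\<^sup>2) powr \<alpha> / pi) *\<^sub>R (cmod (f z))\<^sup>2))"
    by (rule integrable_restrict_space) simp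
  also have "\<dots> \<longleftrightarrow> integrable lborel (\<lambda>z. (1 / pi) * (indicator (ball 0 1) z *\<^sub>R
      ((cmod (f z))\<^sup>2 * (1 - (cmod z)\<^sup>2) powr \<alpha>)))"
    by (intro Bochner_Integration.integrable_cong refl) auto
  also have "\<dots> \<longleftrightarrow> set_integrable lborel (ball 0 1) (\<lambda>z. (cmod (f z))\<^sup>2 * (1 - (cmod z)\<^sup>2) powr \<alpha>)"
    unfolding set_integrable_def using integrable_mult_left_iff [of lborel "1 / pi"] by simp
  finally show ?thesis
    using True f by (simp add: bergman_def L2_def)
qed (simp add: bergman_def)

lemma bergman_lincomb:
  assumes "f \<in> vecs (bergman \<alpha>)" "g \<in> vecs (bergman \<alpha>)"
  shows "(\<lambda>z. a * f z + b * g z) \<in> vecs (bergman \<alpha>)"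
  using assms unfolding vecs_bergman_iff by (auto intro!: holomorphic_intros L2_lincomb)

lemma bergman_diff:
  assumes "f \<in> vecs (bergman \<alpha>)" "g \<in> vecs (bergman \<alpha>)"
  shows "(\<lambda>z. f z - g z) \<in> vecs (bergman \<alpha>)"
  using bergman_lincomb [OF assms, of 1 "-1"] by simp

lemma vecs_bergman_measurable:
  "f \<in> vecs (bergman \<alpha>) \<Longrightarrow> f \<in> borel_measurable (area_measure \<alpha>)"
  by (simp add: vecs_bergman_iff holomorphic_measurable_area_measure)

lemma nn_sq_bergman:
  "f \<in> vecs (bergman \<alpha>) \<Longrightarrow> nn_sq (area_measure \<alpha>) f = ennreal ((hnorm (bergman \<alpha>) f)\<^sup>2)"
  by (simp add: hnorm_bergman_eq_L2 vecs_bergman_measurable nn_sq_eq_hnorm vecs_bergman_iff)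

lemma hnorm_bergman_nonneg:
  "f \<in> vecs (bergman \<alpha>) \<Longrightarrow> 0 \<le> hnorm (bergman \<alpha>) f"
  by (simp add: hnorm_bergman_eq_L2 vecs_bergman_measurable hnorm_L2_nonneg)

lemma parseval_bergman:
  assumes "\<And>z. z \<in> ball 0 1 \<Longrightarrow> (\<lambda>n. a n * z ^ n) sums f z"
  shows "nn_sq (area_measure \<alpha>) f
    = (\<Sum>n. ennreal ((cmod (a n))\<^sup>2) * (\<integral>\<^sup>+z. ennreal (cmod z ^ (2 * n)) \<partial>area_measure \<alpha>))"
proof -
  have "1 - r\<^sup>2 \<noteq> 0" if "r \<in> {0..<1}" for r :: real
    using that power_strict_mono [of r 1 2] by auto
  then have "continuous_on {0..<1} (\<lambda>r::real. (1 - r\<^sup>2) powr \<alpha> / pi)"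
    by (intro continuous_intros) auto
  then show ?thesis
    unfolding nn_sq_def area_measure_def
    by (intro parseval_radial assms) auto
qed

section \<open>Taylor expansions in the Bergman space\<close>

lemma bergman_taylor_sums:
  assumes "f \<in> vecs (bergman \<alpha>)" "z \<in> ball 0 1"
  shows "(\<lambda>n. (deriv ^^ n) f 0 / fact n * z ^ n) sums f z"
  using holomorphic_power_series [of f 0 1 z] assms by (simp add: vecs_bergman_iff)

definition taylor_poly :: "(complex \<Rightarrow> complex) \<Rightarrow> nat \<Rightarrow> complex \<Rightarrow> complex" where
  "taylor_poly f N z = (\<Sum>n<N. (deriv ^^ n) f 0 / fact n * z ^ n)"

text \<open>All norms come from Parseval. The coefficients of \<open>S N\<close> are an initial
  segment of those of \<open>f\<close>, so its norm is at most that of \<open>f\<close>; those of S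
  N - f are the remaining ones with opposite sign, so its squared norm is the tail of a convergent
  series.\<close>

lemma bergman_taylor_poly:
  assumes f: "f \<in> vecs (bergman \<alpha>)"
  defines "S \<equiv> taylor_poly f"
  shows "S N \<in> vecs (bergman \<alpha>)"
    and "S N analytic_on X"
    and "z \<in> ball 0 1 \<Longrightarrow> (\<lambda>N. S N z) \<longlonglongrightarrow> f z"
    and "(\<lambda>N. hnorm (bergman \<alpha>) (\<lambda>z. S N z - f z)) \<longlonglongrightarrow> 0"
proof -
  define a where "a n = (deriv ^^ n) f 0 / fact n" for n
  define c where "c n = (\<integral>\<^sup>+z. ennreal (cmod z ^ (2 * n)) \<partial>area_measure \<alpha>)" for n
  define t where "t n = ennreal ((cmod (a n))\<^sup>2) * c n" for n
  have sums: "(\<lambda>n. a n * z ^ n) sums f z" if "z \<in> ball 0 1" for z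
    using bergman_taylor_sums [OF f that] by (simp add: a_def)
  have S: "S N z = (\<Sum>n<N. a n * z ^ n)" for N z
    by (simp add: S_def a_def taylor_poly_def)
  then have S_fun: "S N = (\<lambda>z. \<Sum>n<N. a n * z ^ n)" for N
    by blast
  show "(\<lambda>N. S N z) \<longlonglongrightarrow> f z" if "z \<in> ball 0 1" for z
    using sums [OF that] by (simp add: sums_def S)
  show "S N analytic_on X" for N
    unfolding S_fun
    by (intro analytic_on_sum analytic_on_mult analytic_on_const analytic_on_power analytic_on_ident)
  \<comment> \<open>The polynomial is presented as a power series with zero coefficients from N on,
    the form in which Parseval accepts it.\<close>
  have partial: "(\<lambda>n. (if n < N then a n else 0) * z ^ n) sums S N z" for N z
  proof -
    have "(\<lambda>n. if n \<in> {..<N} then a n * z ^ n else 0) sums S N z"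
      unfolding S by (rule sums_If_finite_set) simp
    then show ?thesis
      by (rule sums_cong [THEN iffD1, rotated]) simp
  qed
  have tsum: "suminf t < \<infinity>"
  proof -
    have "suminf t = nn_sq (area_measure \<alpha>) f"
      using parseval_bergman [of a f \<alpha>, OF sums] by (simp add: t_def [abs_def] c_def [abs_def])
    also have "\<dots> < \<infinity>" using f by (simp add: nn_sq_bergman)
    finally show ?thesis .
  qed
  have S_vec: "S N \<in> vecs (bergman \<alpha>)" for N
  proof -
    have hol: "S N holomorphic_on ball 0 1"
      unfolding S_fun
      by (intro holomorphic_on_sum holomorphic_on_mult holomorphic_on_const holomorphic_on_power
          holomorphic_on_ident)
    have "nn_sq (area_measure \<alpha>) (S N)
        = (\<Sum>n. ennreal ((cmod (if n < N then a n else 0))\<^sup>2) * c n)"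
      unfolding c_def by (rule parseval_bergman) (rule partial)
    also have "\<dots> \<le> suminf t"
      by (intro suminf_le) (auto simp: t_def)
    finally show ?thesis
      using hol tsum
      by (auto simp: vecs_bergman_iff vecs_L2_iff holomorphic_measurable_area_measure)
  qed
  then show "S N \<in> vecs (bergman \<alpha>)" for N .
  have tail: "nn_sq (area_measure \<alpha>) (\<lambda>z. S N z - f z) = (\<Sum>n. t (n + N))" for N
  proof -
    have eq: "nn_sq (area_measure \<alpha>) (\<lambda>z. S N z - f z)
        = (\<Sum>n. ennreal ((cmod (if n < N then 0 else - a n))\<^sup>2) * c n)"
      unfolding c_def
    proof (rule parseval_bergman)
      fix z :: complex assume "z \<in> ball 0 1"
      then have "(\<lambda>n. (if n < N then a n else 0) * z ^ n - a n * z ^ n) sums (S N z - f z)"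
        by (intro sums_diff sums partial)
      then show "(\<lambda>n. (if n < N then 0 else - a n) * z ^ n) sums (S N z - f z)"
        by (rule sums_cong [THEN iffD1, rotated]) auto
    qed
    also have "\<dots> = (\<Sum>n. if n < N then 0 else t n)"
      by (intro suminf_cong) (auto simp: t_def)
    also have "\<dots> = (\<Sum>n. if n + N < N then 0 else t (n + N))
        + (\<Sum>n<N. if n < N then 0 else t n)"
      by (intro suminf_offset) auto
    finally show ?thesis by simp
  qed
  have fin: "t n < \<infinity>" for n
    using ennreal_suminf_lessD [OF tsum] .
  \<comment> \<open>That tails tend to 0 is a fact about convergent real series; the terms
    \<open>t n\<close> are finite, so the extended series can be replaced by a real one.\<close>
  define t' where "t' n = enn2real (t n)" for n
  have t': "t n = ennreal (t' n)" "0 \<le> t' n" for n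
    using fin [of n] by (auto simp: t'_def)
  have summ: "summable t'"
    using tsum by (intro summable_suminf_not_top t'(2)) (simp flip: t'(1))
  have "(\<Sum>n. t (n + N)) = ennreal (\<Sum>n. t' (n + N))" for N
    using t' summable_ignore_initial_segment [OF summ, of N]
    by (simp add: suminf_ennreal_eq summable_sums)
  then have eq: "ennreal ((hnorm (bergman \<alpha>) (\<lambda>z. S N z - f z))\<^sup>2) = ennreal (\<Sum>n. t' (n + N))" for N
    using tail nn_sq_bergman [OF bergman_diff [OF S_vec f]] by simp
  have "(\<lambda>N. \<Sum>n. t' (n + N)) \<longlonglongrightarrow> 0"
    using suminf_exist_split2 [OF summ] .
  moreover have "(\<Sum>n. t' (n + N)) = (hnorm (bergman \<alpha>) (\<lambda>z. S N z - f z))\<^sup>2" for N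
    using eq [of N] t' summable_ignore_initial_segment [OF summ, of N]
    by (auto simp: suminf_nonneg)
  ultimately have "(\<lambda>N. (hnorm (bergman \<alpha>) (\<lambda>z. S N z - f z))\<^sup>2) \<longlonglongrightarrow> 0"
    by simp
  then show "(\<lambda>N. hnorm (bergman \<alpha>) (\<lambda>z. S N z - f z)) \<longlonglongrightarrow> 0"
    using tendsto_real_sqrt [of "\<lambda>N. (hnorm (bergman \<alpha>) (\<lambda>z. S N z - f z))\<^sup>2" 0 sequentially]
    by (simp add: hnorm_bergman_nonneg [OF bergman_diff [OF S_vec f]])
qed

section \<open>Bounded sequences in the Bergman space\<close>

text \<open>The weight is positive on the annulus, so a null annulus would be Lebesgue null, which a
  nonempty open set is not. This bounds the moments of the measure from below.\<close>

lemma emeasure_area_measure_annulus: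
  assumes "s < 1"
  shows "emeasure (area_measure \<alpha>) {z \<in> ball 0 1. s < cmod z} \<noteq> 0"
proof
  let ?L = "restrict_space lborel (ball (0::complex) 1)"
  let ?E = "{z \<in> ball (0::complex) 1. s < cmod z}"
  have op: "open ?E"
    by (auto simp: Collect_conj_eq intro!: open_Int open_Collect_less continuous_intros)
  assume "emeasure (area_measure \<alpha>) ?E = 0"
  moreover have sets: "?E \<in> sets ?L"
    using op by (auto simp: sets_restrict_space)
  ultimately have "?E \<in> null_sets (area_measure \<alpha>)"
    by (intro null_setsI) (simp_all add: area_measure_def radial_measure_def)
  moreover have "(\<lambda>z. ennreal ((1 - (cmod z)\<^sup>2) powr \<alpha> / pi)) \<in> borel_measurable ?L"
    by (intro measurable_compose [OF _ measurable_ennreal] measurable_radial_weight) measurable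
  ultimately have "AE z in ?L. z \<in> ?E \<longrightarrow> ennreal ((1 - (cmod z)\<^sup>2) powr \<alpha> / pi) = 0"
    unfolding area_measure_def radial_measure_def by (simp add: null_sets_density_iff)
  moreover have "ennreal ((1 - (cmod z)\<^sup>2) powr \<alpha> / pi) \<noteq> 0" if "z \<in> ?E" for z
    using that power_strict_mono [of "cmod z" 1 2] by (auto simp: ennreal_eq_0_iff not_le)
  ultimately have "AE z in ?L. z \<notin> ?E"
    by auto
  then have "AE z in lborel. z \<notin> ?E"
    by (subst (asm) AE_restrict_space_iff) auto
  then have "?E \<in> null_sets lborel"
    using op AE_iff_null_sets [of ?E lborel] by auto
  then have "negligible ?E"
    by (simp add: negligible_iff_null_sets null_sets_completionI)
  moreover obtain x where "max s 0 < x" "x < 1"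
    using dense [of "max s 0" 1] assms by auto
  then have "complex_of_real x \<in> ?E"
    by auto
  ultimately show False
    using open_not_negligible [OF op] by blast
qed

text \<open>A single term of the Parseval series controls a Taylor coefficient: the moment of order
  2n is at least s^(2n) times the mass of the annulus beyond radius s. With s between r and 1, the
  series of \<open>f\<close> on the disc of radius r is dominated by a geometric series of ratio
  r/s.\<close>

lemma bergman_local_bound:
  assumes "0 \<le> r" "r < 1"
  shows "\<exists>C. \<forall>f \<in> vecs (bergman \<alpha>). \<forall>z \<in> cball 0 r. cmod (f z) \<le> C * hnorm (bergman \<alpha>) f"
proof -
  define s where "s = (1 + r) / 2"
  have s: "r < s" "0 < s" "s < 1" using assms by (auto simp: s_def)
  let ?A = "area_measure \<alpha>"
  let ?E = "{z \<in> ball (0::complex) 1. s < cmod z}"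
  have op: "open ?E"
    by (auto simp: Collect_conj_eq intro!: open_Int open_Collect_less continuous_intros)
  have E: "?E \<in> sets ?A"
    using op by (auto simp: area_measure_def sets_radial_measure sets_restrict_space)
  \<comment> \<open>The mass of the annulus is an extended number; \<open>m\<close> is a positive
    real below it, namely the mass itself when finite and 1 otherwise.\<close>
  obtain m where m: "0 < m" "ennreal m \<le> emeasure ?A ?E"
  proof (cases "emeasure ?A ?E")
    case (real x)
    then show ?thesis
      using emeasure_area_measure_annulus [OF s(3), of \<alpha>] that [of x] by auto
  next
    case top
    then show ?thesis using that [of 1] by simp
  qed
  \<comment> \<open>The coefficient bound contributes \<open>1 / sqrt m\<close>, the sum of the
    geometric series the other factor.\<close>
  define C where "C = 1 / (sqrt m * (1 - r / s))"
  show ?thesis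
  proof (intro exI [of _ C] ballI)
    fix f and z :: complex
    assume f: "f \<in> vecs (bergman \<alpha>)" and z: "z \<in> cball 0 r"
    let ?N = "hnorm (bergman \<alpha>) f"
    define a where "a n = (deriv ^^ n) f 0 / fact n" for n
    have sums: "(\<lambda>n. a n * z ^ n) sums f z" if "z \<in> ball 0 1" for z :: complex
      using bergman_taylor_sums [OF f that] by (simp add: a_def)
    have parseval: "nn_sq ?A f
        = (\<Sum>n. ennreal ((cmod (a n))\<^sup>2) * (\<integral>\<^sup>+z. ennreal (cmod z ^ (2 * n)) \<partial>?A))"
      by (rule parseval_bergman) (rule sums)
    have coeff: "cmod (a n) \<le> ?N / (sqrt m * s ^ n)" for n
    proof -
      have "ennreal ((cmod (a n))\<^sup>2 * (m * s ^ (2 * n)))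
          = ennreal ((cmod (a n))\<^sup>2) * (ennreal (s ^ (2 * n)) * ennreal m)"
        using m s by (simp add: ennreal_mult mult.commute)
      also have "\<dots> \<le> ennreal ((cmod (a n))\<^sup>2) * (ennreal (s ^ (2 * n)) * emeasure ?A ?E)"
        using m by (intro mult_left_mono) auto
      also have "ennreal (s ^ (2 * n)) * emeasure ?A ?E
          = (\<integral>\<^sup>+z. ennreal (s ^ (2 * n)) * indicator ?E z \<partial>?A)"
        using E by (simp add: nn_integral_cmult_indicator)
      also have "\<dots> \<le> (\<integral>\<^sup>+z. ennreal (cmod z ^ (2 * n)) \<partial>?A)"
        using s by (intro nn_integral_mono)
          (auto split: split_indicator intro!: ennreal_leI power_mono)
      also have "ennreal ((cmod (a n))\<^sup>2) * (\<integral>\<^sup>+z. ennreal (cmod z ^ (2 * n)) \<partial>?A) \<le> nn_sq ?A f"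
        unfolding parseval
        using sum_le_suminf [of "\<lambda>n. ennreal ((cmod (a n))\<^sup>2) * (\<integral>\<^sup>+z. ennreal (cmod z ^ (2 * n)) \<partial>?A)" "{n}"]
        by simp
      also have "nn_sq ?A f = ennreal (?N\<^sup>2)"
        by (rule nn_sq_bergman [OF f])
      finally have "(cmod (a n))\<^sup>2 * (m * s ^ (2 * n)) \<le> ?N\<^sup>2"
        by (simp add: mult_left_mono)
      moreover have "(cmod (a n) * (sqrt m * s ^ n))\<^sup>2 = (cmod (a n))\<^sup>2 * (m * s ^ (2 * n))"
        using m by (simp add: power_mult_distrib power_mult [symmetric] mult.commute)
      ultimately have "cmod (a n) * (sqrt m * s ^ n) \<le> ?N"
        by (intro power2_le_imp_le [OF _ hnorm_bergman_nonneg [OF f]]) simp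
      then show ?thesis
        using m s by (simp add: pos_le_divide_eq)
    qed
    have z1: "z \<in> ball 0 1" using z assms by auto
    have term_le: "cmod (a n * z ^ n) \<le> ?N / sqrt m * (r / s) ^ n" for n
    proof -
      have "cmod (a n * z ^ n) = cmod (a n) * cmod z ^ n"
        by (simp add: norm_mult norm_power)
      also have "\<dots> \<le> ?N / (sqrt m * s ^ n) * r ^ n"
        using z m s by (intro mult_mono coeff power_mono)
          (auto simp: hnorm_bergman_nonneg [OF f])
      finally show ?thesis by (simp add: power_divide)
    qed
    have geo: "(\<lambda>n. ?N / sqrt m * (r / s) ^ n) sums (?N / sqrt m * (1 / (1 - r / s)))"
      using assms s by (intro sums_mult geometric_sums) simp
    have "cmod (f z) = cmod (\<Sum>n. a n * z ^ n)"
      using sums [OF z1] by (simp add: sums_iff)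
    also have "\<dots> \<le> (\<Sum>n. ?N / sqrt m * (r / s) ^ n)"
      by (rule norm_suminf_le [OF term_le]) (use geo in \<open>simp add: sums_iff\<close>)
    also have "\<dots> = C * ?N"
      using geo by (simp add: sums_iff C_def)
    finally show "cmod (f z) \<le> C * ?N" .
  qed
qed

text \<open>A concrete form of weak sequential compactness of balls: the local bound makes the
  sequence a normal family, and Fatou's lemma keeps the pointwise limit in the space.\<close>

lemma bergman_bounded_subsequence:
  fixes F :: "nat \<Rightarrow> complex \<Rightarrow> complex"
  assumes F: "\<And>n. F n \<in> vecs (bergman \<alpha>)" and B: "\<And>n. hnorm (bergman \<alpha>) (F n) \<le> B"
  shows "\<exists>(r :: nat \<Rightarrow> nat) f. strict_mono r \<and> f \<in> vecs (bergman \<alpha>) \<and>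
    (\<forall>z \<in> ball 0 1. (\<lambda>n. F (r n) z) \<longlonglongrightarrow> f z)"
proof -
  have "\<exists>C. \<forall>h \<in> range F. \<forall>z \<in> K. cmod (h z) \<le> C" if K: "compact K" "K \<subseteq> ball 0 1" for K
  proof -
    obtain r where r: "0 \<le> r" "r < 1" "K \<subseteq> cball 0 r"
    proof (cases "K = {}")
      case True
      then show ?thesis using that [of 0] by simp
    next
      case False
      then obtain w where w: "w \<in> K" "\<And>z. z \<in> K \<Longrightarrow> cmod z \<le> cmod w"
        using continuous_attains_sup [of K cmod] K(1) by (auto intro: continuous_intros)
      show ?thesis
        by (rule that [of "cmod w"]) (use w K(2) in auto)
    qed
    obtain C where C: "\<And>f z. f \<in> vecs (bergman \<alpha>) \<Longrightarrow> z \<in> cball 0 r \<Longrightarrow>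
        cmod (f z) \<le> C * hnorm (bergman \<alpha>) f"
      using bergman_local_bound [OF r(1,2), of \<alpha>] by blast
    have "cmod (F n z) \<le> \<bar>C\<bar> * B" if "z \<in> K" for n z
    proof -
      have "cmod (F n z) \<le> C * hnorm (bergman \<alpha>) (F n)"
        using C [OF F] that r by blast
      also have "\<dots> \<le> \<bar>C\<bar> * B"
        using B [of n] by (intro mult_mono) (auto simp: hnorm_bergman_nonneg [OF F])
      finally show ?thesis .
    qed
    then show ?thesis by blast
  qed
  moreover have hol: "h holomorphic_on ball 0 1" if "h \<in> range F" for h
    using that F by (auto simp: vecs_bergman_iff)
  ultimately obtain f r where f: "f holomorphic_on ball 0 1" and r: "strict_mono (r :: nat \<Rightarrow> nat)"
    and lim: "\<And>z. z \<in> ball 0 1 \<Longrightarrow> (\<lambda>n. F (r n) z) \<longlonglongrightarrow> f z"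
    using Montel [of "ball 0 1" "range F" F] by (metis open_ball order_refl)
  have B0: "0 \<le> B"
    using B [of 0] hnorm_bergman_nonneg [OF F [of 0]] by linarith
  have "nn_sq (area_measure \<alpha>) f \<le> liminf (\<lambda>n. nn_sq (area_measure \<alpha>) (F (r n)))"
    by (rule fatou_nn_sq) (use lim in \<open>auto intro!: AE_I2 vecs_bergman_measurable F\<close>)
  also have "\<dots> \<le> liminf (\<lambda>n. ennreal (B\<^sup>2))"
    by (intro Liminf_mono always_eventually allI)
      (auto simp: nn_sq_bergman [OF F] intro!: ennreal_leI power_mono B hnorm_bergman_nonneg F)
  also have "\<dots> < \<infinity>"
    by (simp add: Liminf_const)
  finally have "f \<in> vecs (bergman \<alpha>)"
    using f by (simp add: vecs_bergman_iff vecs_L2_iff holomorphic_measurable_area_measure)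
  with r lim show ?thesis by blast
qed

text \<open>
  Compactness is stated with limits in the target space.  For an operator that respects pointwise
  convergence these limits can be taken in its range, which makes compactness depend only on the
  norms \<open>\<parallel>T f - T g\<parallel>\<close>: a bounded sequence has a pointwise convergent subsequence by Montel, and by
  Fatou the norm limit of its image is the image of the pointwise limit.
\<close>

lemma compact_op_iff_subsequence:
  assumes K: "\<And>f. f \<in> vecs K \<Longrightarrow> f \<in> vecs (L2 M)"
      "\<And>f g. f \<in> vecs K \<Longrightarrow> g \<in> vecs K \<Longrightarrow>
        hnorm K (\<lambda>z. f z - g z) = hnorm (L2 M) (\<lambda>z. f z - g z)"
    and bdd: "bounded_op (bergman \<alpha>) K T"
    and cont: "\<And>F f. (\<And>n. F n \<in> vecs (bergman \<alpha>)) \<Longrightarrow> f \<in> vecs (bergman \<alpha>) \<Longrightarrow>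
      (\<And>z. z \<in> ball 0 1 \<Longrightarrow> (\<lambda>n. F n z) \<longlonglongrightarrow> f z) \<Longrightarrow>
      AE z in M. (\<lambda>n. T (F n) z) \<longlonglongrightarrow> T f z"
  shows "compact_op (bergman \<alpha>) K T \<longleftrightarrow>
    (\<forall>F :: nat \<Rightarrow> complex \<Rightarrow> complex. (\<forall>n. F n \<in> vecs (bergman \<alpha>)) \<and> (\<exists>B. \<forall>n. hnorm (bergman \<alpha>) (F n) \<le> B) \<longrightarrow>
      (\<exists>r f. strict_mono r \<and> f \<in> vecs (bergman \<alpha>) \<and>
        (\<lambda>n. hnorm K (\<lambda>z. T (F (r n)) z - T f z)) \<longlonglongrightarrow> 0))" (is "_ \<longleftrightarrow> ?R")
proof
  have T: "T f \<in> vecs K" if "f \<in> vecs (bergman \<alpha>)" for f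
    using bdd that by (simp add: bounded_op_def linear_op_def)
  {
    assume R: ?R
    show "compact_op (bergman \<alpha>) K T"
      unfolding compact_op_def
    proof (intro conjI bdd allI impI)
      fix F :: "nat \<Rightarrow> complex \<Rightarrow> complex"
      assume "(\<forall>n. F n \<in> vecs (bergman \<alpha>)) \<and> (\<exists>B. \<forall>n. hnorm (bergman \<alpha>) (F n) \<le> B)"
      then obtain r f where "strict_mono (r :: nat \<Rightarrow> nat)" "f \<in> vecs (bergman \<alpha>)"
        "(\<lambda>n. hnorm K (\<lambda>z. T (F (r n)) z - T f z)) \<longlonglongrightarrow> 0"
        using R by blast
      then show "\<exists>r g. strict_mono r \<and> g \<in> vecs K \<and>
          (\<lambda>n. hnorm K (\<lambda>z. T (F (r n)) z - g z)) \<longlonglongrightarrow> 0"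
        using T by blast
    qed
  next
    assume comp: "compact_op (bergman \<alpha>) K T"
    show ?R
    proof (intro allI impI, elim conjE exE)
      fix F :: "nat \<Rightarrow> complex \<Rightarrow> complex" and B
      assume F: "\<forall>n. F n \<in> vecs (bergman \<alpha>)" and B: "\<forall>n. hnorm (bergman \<alpha>) (F n) \<le> B"
      from F B comp obtain r g where r: "strict_mono (r :: nat \<Rightarrow> nat)" and g: "g \<in> vecs K"
        and lim: "(\<lambda>n. hnorm K (\<lambda>z. T (F (r n)) z - g z)) \<longlonglongrightarrow> 0"
        unfolding compact_op_def by meson
      \<comment> \<open>Along \<open>r\<close> the images converge in norm; thinning to
        \<open>r'\<close> adds a pointwise limit of the functions themselves, which
        \<open>cont\<close> carries over to the images.\<close>
      obtain r' f where r': "strict_mono (r' :: nat \<Rightarrow> nat)" and f: "f \<in> vecs (bergman \<alpha>)"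
        and ptw: "\<And>z. z \<in> ball 0 1 \<Longrightarrow> (\<lambda>n. F (r (r' n)) z) \<longlonglongrightarrow> f z"
        using bergman_bounded_subsequence [of "\<lambda>n. F (r n)" \<alpha> B] F B by blast
      have Tf: "T f \<in> vecs (L2 M)" and gM: "g \<in> vecs (L2 M)"
        using K(1) T f g by auto
      have TF: "T (F n) \<in> vecs K" for n using T F by blast
      have lim': "(\<lambda>n. hnorm K (\<lambda>z. T (F (r (r' n))) z - g z)) \<longlonglongrightarrow> 0"
        using LIMSEQ_subseq_LIMSEQ [OF lim r'] by (simp add: o_def)
      \<comment> \<open>The abstract norm limit \<open>g\<close> is identified as an element of the
        range of \<open>T\<close>.\<close>
      have ae: "AE z in M. T f z = g z"
      proof (rule L2_limit_eq_pointwise_limit)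
        show "T (F (r (r' n))) \<in> vecs (L2 M)" for n
          using K(1) TF by blast
        show "AE z in M. (\<lambda>n. T (F (r (r' n))) z) \<longlonglongrightarrow> T f z"
          by (rule cont) (use F f ptw in auto)
        show "(\<lambda>n. hnorm (L2 M) (\<lambda>z. T (F (r (r' n))) z - g z)) \<longlonglongrightarrow> 0"
          using lim' by (simp add: K(2) [OF TF g])
      qed (use Tf gM in \<open>auto simp: L2_def\<close>)
      have "hnorm K (\<lambda>z. T (F (r (r' n))) z - T f z) = hnorm K (\<lambda>z. T (F (r (r' n))) z - g z)" for n
      proof -
        have "T (F (r (r' n))) \<in> vecs (L2 M)" using K(1) TF by blast
        then have "hnorm (L2 M) (\<lambda>z. T (F (r (r' n))) z - T f z)
            = hnorm (L2 M) (\<lambda>z. T (F (r (r' n))) z - g z)"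
          using ae Tf gM by (intro hnorm_L2_cong_AE) (auto simp: L2_def)
        then show ?thesis
          by (simp add: K(2) [OF TF g] K(2) [OF TF T [OF f]])
      qed
      then have "(\<lambda>n. hnorm K (\<lambda>z. T (F ((r \<circ> r') n)) z - T f z)) \<longlonglongrightarrow> 0"
        using lim' by simp
      moreover have "strict_mono (r \<circ> r')"
        using r r' by (rule strict_mono_o)
      ultimately show "\<exists>r f. strict_mono r \<and> f \<in> vecs (bergman \<alpha>) \<and>
          (\<lambda>n. hnorm K (\<lambda>z. T (F (r n)) z - T f z)) \<longlonglongrightarrow> 0"
        using f by blast
    qed
  }
qed

section \<open>The Carleson measure\<close>

definition push_measure :: "real \<Rightarrow> (complex \<Rightarrow> complex) \<Rightarrow> (complex \<Rightarrow> complex) \<Rightarrow> complex measure" where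
  "push_measure \<alpha> h \<phi> =
     distr (density (area_measure \<alpha>) (\<lambda>z. ennreal ((cmod (h z))\<^sup>2)))
       (restrict_space borel (cball 0 1)) \<phi>"

locale weighted_composition =
  fixes \<alpha> :: real and h \<phi> :: "complex \<Rightarrow> complex"
  assumes hol_\<phi>: "\<phi> holomorphic_on ball 0 1"
    and \<phi>_ball: "\<phi> ` ball 0 1 \<subseteq> ball 0 1"
    and h: "h \<in> vecs (bergman \<alpha>)"
begin

abbreviation "A \<equiv> area_measure \<alpha>"
abbreviation "\<mu> \<equiv> push_measure \<alpha> h \<phi>"
abbreviation "W \<equiv> weighted_comp h \<phi>"

lemma h_measurable [measurable]: "h \<in> borel_measurable A"
  by (rule vecs_bergman_measurable [OF h])

lemma sets_\<mu>: "sets \<mu> = sets (restrict_space borel (cball 0 1))"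
  by (simp add: push_measure_def)

lemma space_\<mu> [simp]: "space \<mu> = cball 0 1"
  by (simp add: push_measure_def space_restrict_space)

lemma \<phi>_measurable: "\<phi> \<in> measurable (density A (\<lambda>z. ennreal ((cmod (h z))\<^sup>2))) (restrict_space borel (cball 0 1))"
proof (rule measurable_restrict_space2)
  show "\<phi> \<in> borel_measurable (density A (\<lambda>z. ennreal ((cmod (h z))\<^sup>2)))"
    using holomorphic_measurable_area_measure [OF hol_\<phi>, of \<alpha>] by simp
  show "\<phi> \<in> space (density A (\<lambda>z. ennreal ((cmod (h z))\<^sup>2))) \<rightarrow> cball 0 1"
    using \<phi>_ball ball_subset_cball by fastforce
qed

lemma \<mu>_measurable_cong: "borel_measurable \<mu> = borel_measurable (restrict_space borel (cball 0 1))"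
  by (rule measurable_cong_sets [OF sets_\<mu> refl])

lemma comp_\<phi>_measurable:
  "F \<in> borel_measurable \<mu> \<Longrightarrow> (\<lambda>z. F (\<phi> z)) \<in> borel_measurable A"
  using measurable_compose [OF \<phi>_measurable, of F] by (simp add: \<mu>_measurable_cong)

lemma nn_integral_\<mu>:
  assumes "F \<in> borel_measurable \<mu>"
  shows "(\<integral>\<^sup>+z. F z \<partial>\<mu>) = (\<integral>\<^sup>+z. ennreal ((cmod (h z))\<^sup>2) * F (\<phi> z) \<partial>A)"
proof -
  have "(\<integral>\<^sup>+z. F z \<partial>\<mu>) = (\<integral>\<^sup>+z. F (\<phi> z) \<partial>density A (\<lambda>z. ennreal ((cmod (h z))\<^sup>2)))"
    using assms unfolding push_measure_def
    by (intro nn_integral_distr \<phi>_measurable) (simp add: \<mu>_measurable_cong)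
  also have "\<dots> = (\<integral>\<^sup>+z. ennreal ((cmod (h z))\<^sup>2) * F (\<phi> z) \<partial>A)"
    using comp_\<phi>_measurable [OF assms] by (intro nn_integral_density) measurable
  finally show ?thesis .
qed

lemma integral_\<mu>:
  fixes F :: "complex \<Rightarrow> complex"
  assumes "F \<in> borel_measurable \<mu>"
  shows "(LINT z|\<mu>. F z) = (LINT z|A. (cmod (h z))\<^sup>2 *\<^sub>R F (\<phi> z))"
proof -
  have "(LINT z|\<mu>. F z) = (LINT z|density A (\<lambda>z. ennreal ((cmod (h z))\<^sup>2)). F (\<phi> z))"
    using assms unfolding push_measure_def
    by (intro integral_distr \<phi>_measurable) (simp add: \<mu>_measurable_cong)
  also have "\<dots> = (LINT z|A. (cmod (h z))\<^sup>2 *\<^sub>R F (\<phi> z))"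
    using comp_\<phi>_measurable [OF assms] by (intro integral_density) auto
  finally show ?thesis .
qed

text \<open>\<open>\<phi>\<close> takes values in the open disc, so the circle carries no mass.
  Hence a function given only on the open disc determines a class in
  \<open>L2 \<mu>\<close>.\<close>

lemma AE_\<mu>_ball: "AE z in \<mu>. z \<in> ball 0 1"
proof -
  have "{z \<in> space (restrict_space borel (cball (0::complex) 1)). z \<in> ball 0 1}
      \<in> sets (restrict_space borel (cball 0 1))"
    by (auto simp: space_restrict_space sets_restrict_space intro!: image_eqI [where x = "ball 0 1"])
  then show ?thesis
    unfolding push_measure_def
    by (subst AE_distr_iff [OF \<phi>_measurable])
      (use \<phi>_ball in \<open>auto simp: image_subset_iff intro!: AE_I2\<close>)
qed

text \<open>The total mass is the squared Bergman norm of \<open>h\<close>.\<close>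

lemma finite_borel_\<mu>: "finite_borel_cdisc \<mu>"
  unfolding finite_borel_cdisc_def
proof
  show "finite_measure \<mu>"
  proof
    have "emeasure \<mu> (space \<mu>) = (\<integral>\<^sup>+z. 1 \<partial>\<mu>)"
      by simp
    also have "\<dots> = nn_sq A h"
      by (subst nn_integral_\<mu>) (auto simp: nn_sq_def)
    also have "\<dots> < \<infinity>"
      using h by (simp add: nn_sq_bergman)
    finally show "emeasure \<mu> (space \<mu>) \<noteq> \<infinity>" by simp
  qed
qed (rule sets_\<mu>)

lemma W_holomorphic: "f holomorphic_on ball 0 1 \<Longrightarrow> W f holomorphic_on ball 0 1"
  unfolding weighted_comp_def
  using h hol_\<phi> holomorphic_on_compose_gen [OF hol_\<phi> _ \<phi>_ball, of f]
  by (auto intro!: holomorphic_on_mult simp: vecs_bergman_iff o_def)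

lemma W_diff: "(\<lambda>z. W f z - W g z) = W (\<lambda>z. f z - g z)"
  by (simp add: weighted_comp_def right_diff_distrib)

text \<open>
  Functions in the Bergman space carry no information outside the open disc, so their
  representatives in \<open>L\<^sup>2(\<mu>)\<close> are cut off there.
\<close>

definition cut_off :: "(complex \<Rightarrow> complex) \<Rightarrow> (complex \<Rightarrow> complex)" where
  "cut_off f z = (if z \<in> ball 0 1 then f z else 0)"

lemma cut_off_measurable:
  assumes "f holomorphic_on ball 0 1"
  shows "cut_off f \<in> borel_measurable \<mu>"
proof -
  have "cut_off f \<in> borel_measurable borel"
    unfolding cut_off_def [abs_def]
    by (intro borel_measurable_continuous_on_if holomorphic_on_imp_continuous_on assms) auto
  then show ?thesis
    unfolding \<mu>_measurable_cong by (rule measurable_restrict_space1)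
qed

lemma AE_\<mu>_cut_off: "AE z in \<mu>. cut_off f z = f z"
  using AE_\<mu>_ball by eventually_elim (simp add: cut_off_def)

text \<open>Being an identity in the extended reals for every holomorphic \<open>f\<close>, it
  transfers square integrability as well as norms, which matters because \<open>W\<close> may be
  unbounded.\<close>

lemma nn_sq_cut_off:
  assumes "f holomorphic_on ball 0 1"
  shows "nn_sq \<mu> (cut_off f) = nn_sq A (W f)"
proof -
  have [measurable]: "cut_off f \<in> borel_measurable \<mu>"
    by (rule cut_off_measurable [OF assms])
  have "nn_sq \<mu> (cut_off f)
      = (\<integral>\<^sup>+z. ennreal ((cmod (h z))\<^sup>2) * ennreal ((cmod (cut_off f (\<phi> z)))\<^sup>2) \<partial>A)"
    unfolding nn_sq_def by (rule nn_integral_\<mu>) measurable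
  also have "\<dots> = nn_sq A (W f)"
    unfolding nn_sq_def using \<phi>_ball
    by (intro nn_integral_cong)
      (auto simp: cut_off_def weighted_comp_def norm_mult power_mult_distrib ennreal_mult image_subset_iff)
  finally show ?thesis .
qed

text \<open>Inner products, and not only norms, are compared because the eigenspaces behind the
  singular values are defined by them.\<close>

lemma ip_cut_off:
  assumes "f holomorphic_on ball 0 1" "g holomorphic_on ball 0 1"
  shows "ip (L2 \<mu>) (cut_off f) (cut_off g) = ip (bergman \<alpha>) (W f) (W g)"
proof -
  have [measurable]: "cut_off f \<in> borel_measurable \<mu>" "cut_off g \<in> borel_measurable \<mu>"
    by (intro cut_off_measurable assms)+
  have [measurable]: "cnj \<in> borel_measurable borel"
    by (intro borel_measurable_continuous_onI continuous_intros)
  have "ip (L2 \<mu>) (cut_off f) (cut_off g)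
      = (LINT z|A. (cmod (h z))\<^sup>2 *\<^sub>R (cut_off f (\<phi> z) * cnj (cut_off g (\<phi> z))))"
    unfolding L2_def fun_hilbert.simps by (rule integral_\<mu>) measurable
  also have "\<dots> = (LINT z|A. W f z * cnj (W g z))"
    using \<phi>_ball
    by (intro Bochner_Integration.integral_cong refl)
      (auto simp: cut_off_def weighted_comp_def scaleR_conv_of_real complex_norm_square image_subset_iff
        simp del: of_real_power)
  also have "\<dots> = ip (bergman \<alpha>) (W f) (W g)"
    by (simp add: ip_bergman holomorphic_measurable_area_measure W_holomorphic assms) (simp add: L2_def)
  finally show ?thesis .
qed

lemma W_in_bergman_iff:
  "f holomorphic_on ball 0 1 \<Longrightarrow> W f \<in> vecs (bergman \<alpha>) \<longleftrightarrow> cut_off f \<in> vecs (L2 \<mu>)"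
  by (simp add: vecs_bergman_iff vecs_L2_iff W_holomorphic holomorphic_measurable_area_measure
      cut_off_measurable nn_sq_cut_off)

text \<open>The one property of an extension on which the transfer to \<open>W\<close> rests.
  Measurability is demanded separately because equality almost everywhere does not imply it when the
  measure is not complete.\<close>

definition represents_identity :: "((complex \<Rightarrow> complex) \<Rightarrow> (complex \<Rightarrow> complex)) \<Rightarrow> bool" where
  "represents_identity J \<longleftrightarrow>
     (\<forall>f \<in> vecs (bergman \<alpha>). J f \<in> borel_measurable \<mu> \<and> (AE z in \<mu>. J f z = f z))"

lemma extends_carleson_cut_off: "extends_carleson \<mu> cut_off"
  by (simp add: extends_carleson_def AE_\<mu>_cut_off)

lemma represents_identity_cut_off: "represents_identity cut_off"
  by (simp add: represents_identity_def AE_\<mu>_cut_off cut_off_measurable vecs_bergman_iff)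

text \<open>
  The Taylor polynomials \<open>S\<^sub>N\<close> of \<open>f\<close> are analytic on the closed disc, so \<open>J S\<^sub>N = S\<^sub>N\<close>; they
  converge to \<open>f\<close> pointwise, while \<open>J S\<^sub>N\<close> converges to \<open>J f\<close> in norm.
\<close>

lemma bounded_extension_represents_identity:
  assumes ext: "extends_carleson \<mu> J" and bdd: "bounded_op (bergman \<alpha>) (L2 \<mu>) J"
  shows "represents_identity J"
  unfolding represents_identity_def
proof (intro ballI conjI)
  fix f assume f: "f \<in> vecs (bergman \<alpha>)"
  have J: "J g \<in> vecs (L2 \<mu>)" if "g \<in> vecs (bergman \<alpha>)" for g
    using bdd that by (simp add: bounded_op_def linear_op_def)
  then show meas: "J f \<in> borel_measurable \<mu>"
    using f by (simp add: vecs_L2_iff)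
  define S where "S = taylor_poly f"
  note S = bergman_taylor_poly [OF f, folded S_def]
  obtain C where C: "\<And>g. g \<in> vecs (bergman \<alpha>) \<Longrightarrow> hnorm (L2 \<mu>) (J g) \<le> C * hnorm (bergman \<alpha>) g"
    using bdd by (auto simp: bounded_op_def)
  have le: "hnorm (L2 \<mu>) (\<lambda>z. J (S N) z - J f z) \<le> C * hnorm (bergman \<alpha>) (\<lambda>z. S N z - f z)" for N
  proof -
    let ?d = "\<lambda>z. S N z - f z"
    have d: "?d \<in> vecs (bergman \<alpha>)"
      by (rule bergman_diff [OF S(1) f])
    \<comment> \<open>\<open>linear_op\<close> gives additivity only up to norm 0, so J(S N - f) =
      J(S N) - J f is first obtained in this form and then turned into an equality almost
      everywhere.\<close>
    have "hnorm (L2 \<mu>) (\<lambda>z. J (\<lambda>w. 1 * S N w + (-1) * f w) z - (1 * J (S N) z + (-1) * J f z)) = 0"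
      using bdd S(1) [of N] f unfolding bounded_op_def linear_op_def by blast
    then have "hnorm (L2 \<mu>) (\<lambda>z. J ?d z - (J (S N) z - J f z)) = 0"
      by simp
    moreover have "(\<lambda>z. J ?d z - (J (S N) z - J f z)) \<in> vecs (L2 \<mu>)"
      by (intro L2_diff J d S(1) f)
    ultimately have "AE z in \<mu>. J ?d z - (J (S N) z - J f z) = 0"
      by (simp add: hnorm_L2_eq_0_iff)
    then have "AE z in \<mu>. J (S N) z - J f z = J ?d z"
      by eventually_elim simp
    then have "hnorm (L2 \<mu>) (\<lambda>z. J (S N) z - J f z) = hnorm (L2 \<mu>) (J ?d)"
      using J [OF d] L2_diff [OF J [OF S(1)] J [OF f]]
      by (intro hnorm_L2_cong_AE) (auto simp: vecs_L2_iff)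
    then show ?thesis
      using C [OF d] by simp
  qed
  have "AE z in \<mu>. cut_off f z = J f z"
  proof (rule L2_limit_eq_pointwise_limit)
    \<comment> \<open>Each N comes with its own exceptional null set; there are countably
      many.\<close>
    have "AE z in \<mu>. \<forall>N. J (S N) z = S N z"
      unfolding AE_all_countable using ext S(2) by (auto simp: extends_carleson_def)
    then show "AE z in \<mu>. (\<lambda>N. J (S N) z) \<longlonglongrightarrow> cut_off f z"
      using AE_\<mu>_ball
    proof eventually_elim
      case (elim z)
      then show ?case using S(3) [of z] by (simp add: cut_off_def)
    qed
    show "(\<lambda>N. hnorm (L2 \<mu>) (\<lambda>z. J (S N) z - J f z)) \<longlonglongrightarrow> 0"
    proof (rule tendsto_sandwich [OF _ _ tendsto_const])
      show "(\<lambda>N. C * hnorm (bergman \<alpha>) (\<lambda>z. S N z - f z)) \<longlonglongrightarrow> 0"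
        using tendsto_mult_left [OF S(4), of C] by simp
    qed (auto simp: le hnorm_L2_nonneg)
    show "cut_off f \<in> borel_measurable \<mu>"
      using f by (simp add: cut_off_measurable vecs_bergman_iff)
  qed (auto intro: J S(1) f)
  then show "AE z in \<mu>. J f z = f z"
    using AE_\<mu>_cut_off [of f] by eventually_elim simp
qed

section \<open>Transfer of properties between the embedding and the weighted composition
  operator\<close>

context
  fixes J assumes J: "represents_identity J"
begin

lemma J_measurable: "f \<in> vecs (bergman \<alpha>) \<Longrightarrow> J f \<in> borel_measurable \<mu>"
  using J by (simp add: represents_identity_def)

lemma J_eq_cut_off: "f \<in> vecs (bergman \<alpha>) \<Longrightarrow> AE z in \<mu>. J f z = cut_off f z"
  using J AE_\<mu>_cut_off [of f] unfolding represents_identity_def by (auto elim!: eventually_elim2)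

lemma J_in_L2_iff:
  assumes "f \<in> vecs (bergman \<alpha>)"
  shows "J f \<in> vecs (L2 \<mu>) \<longleftrightarrow> W f \<in> vecs (bergman \<alpha>)"
proof -
  have "nn_sq \<mu> (J f) = nn_sq \<mu> (cut_off f)"
    unfolding nn_sq_def using J_eq_cut_off [OF assms]
    by (intro nn_integral_cong_AE) (auto elim!: eventually_mono)
  moreover have "f holomorphic_on ball 0 1"
    using assms by (simp add: vecs_bergman_iff)
  ultimately show ?thesis
    using assms by (simp add: W_in_bergman_iff vecs_L2_iff J_measurable cut_off_measurable)
qed

lemma ip_J:
  assumes "f \<in> vecs (bergman \<alpha>)" "g \<in> vecs (bergman \<alpha>)"
  shows "ip (L2 \<mu>) (J f) (J g) = ip (bergman \<alpha>) (W f) (W g)"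
proof -
  have hol: "f holomorphic_on ball 0 1" "g holomorphic_on ball 0 1"
    using assms by (auto simp: vecs_bergman_iff)
  have [measurable]: "J f \<in> borel_measurable \<mu>" "J g \<in> borel_measurable \<mu>"
      "cut_off f \<in> borel_measurable \<mu>" "cut_off g \<in> borel_measurable \<mu>"
    using assms hol by (auto intro: J_measurable cut_off_measurable)
  have [measurable]: "cnj \<in> borel_measurable borel"
    by (intro borel_measurable_continuous_onI continuous_intros)
  have "AE z in \<mu>. J f z * cnj (J g z) = cut_off f z * cnj (cut_off g z)"
    using J_eq_cut_off [OF assms(1)] J_eq_cut_off [OF assms(2)] by eventually_elim simp
  then have "ip (L2 \<mu>) (J f) (J g) = ip (L2 \<mu>) (cut_off f) (cut_off g)"
    unfolding L2_def fun_hilbert.simps by (intro integral_cong_AE) measurable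
  then show ?thesis
    by (simp add: ip_cut_off hol)
qed

lemma hnorm_J:
  "f \<in> vecs (bergman \<alpha>) \<Longrightarrow> hnorm (L2 \<mu>) (J f) = hnorm (bergman \<alpha>) (W f)"
  by (simp add: hnorm_def ip_J)

text \<open>\<open>J\<close> respects differences only outside a null set, so J f - J g is first
  replaced by the image of f - g; for \<open>W\<close> the same identity is exact.\<close>

lemma hnorm_J_diff:
  assumes "f \<in> vecs (bergman \<alpha>)" "g \<in> vecs (bergman \<alpha>)"
  shows "hnorm (L2 \<mu>) (\<lambda>z. J f z - J g z) = hnorm (bergman \<alpha>) (\<lambda>z. W f z - W g z)"
proof -
  have d: "(\<lambda>z. f z - g z) \<in> vecs (bergman \<alpha>)"
    by (rule bergman_diff [OF assms])
  have [measurable]: "J f \<in> borel_measurable \<mu>" "J g \<in> borel_measurable \<mu>"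
    "J (\<lambda>z. f z - g z) \<in> borel_measurable \<mu>"
    by (intro J_measurable assms d)+
  have "AE z in \<mu>. J f z - J g z = J (\<lambda>z. f z - g z) z"
    using J_eq_cut_off [OF assms(1)] J_eq_cut_off [OF assms(2)] J_eq_cut_off [OF d]
    by eventually_elim (simp add: cut_off_def)
  then have "hnorm (L2 \<mu>) (\<lambda>z. J f z - J g z) = hnorm (L2 \<mu>) (J (\<lambda>z. f z - g z))"
    by (rule hnorm_L2_cong_AE) measurable
  then show ?thesis
    by (simp add: hnorm_J [OF d] W_diff)
qed

text \<open>An operator that acts as the identity almost everywhere is linear in the sense of
  classes, so only the range condition carries information.\<close>

lemma linear_J_iff: "linear_op (bergman \<alpha>) (L2 \<mu>) J \<longleftrightarrow> (\<forall>f \<in> vecs (bergman \<alpha>). J f \<in> vecs (L2 \<mu>))"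
proof (intro iffI)
  assume L: "\<forall>f \<in> vecs (bergman \<alpha>). J f \<in> vecs (L2 \<mu>)"
  have "hnorm (L2 \<mu>) (\<lambda>z. J (\<lambda>w. a * f w + b * g w) z - (a * J f z + b * J g z)) = 0"
    if f: "f \<in> vecs (bergman \<alpha>)" and g: "g \<in> vecs (bergman \<alpha>)" for f g a b
  proof -
    let ?l = "\<lambda>w. a * f w + b * g w"
    have l: "?l \<in> vecs (bergman \<alpha>)"
      by (rule bergman_lincomb [OF f g])
    have "(\<lambda>z. J ?l z - (a * J f z + b * J g z)) \<in> vecs (L2 \<mu>)"
      using L f g l by (intro L2_diff L2_lincomb) auto
    moreover have "AE z in \<mu>. J ?l z - (a * J f z + b * J g z) = 0"
      using J_eq_cut_off [OF f] J_eq_cut_off [OF g] J_eq_cut_off [OF l]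
      by eventually_elim (simp add: cut_off_def)
    ultimately show ?thesis
      by (simp add: hnorm_L2_eq_0_iff)
  qed
  with L show "linear_op (bergman \<alpha>) (L2 \<mu>) J"
    by (simp add: linear_op_def)
qed (simp add: linear_op_def)

lemma linear_W_iff:
  "linear_op (bergman \<alpha>) (bergman \<alpha>) W \<longleftrightarrow> (\<forall>f \<in> vecs (bergman \<alpha>). W f \<in> vecs (bergman \<alpha>))"
  by (auto simp: linear_op_def weighted_comp_def hnorm_bergman algebra_simps)

lemma bounded_J_iff:
  "bounded_op (bergman \<alpha>) (L2 \<mu>) J \<longleftrightarrow> bounded_op (bergman \<alpha>) (bergman \<alpha>) W"
  unfolding bounded_op_def linear_J_iff linear_W_iff by (simp add: J_in_L2_iff hnorm_J)

text \<open>With limits taken in the range, compactness of either operator becomes the same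
  condition on the norms of J f - J g and W f - W g, which coincide. If \<open>W\<close> is
  unbounded, both sides fail by definition.\<close>

lemma compact_J_iff:
  "compact_op (bergman \<alpha>) (L2 \<mu>) J \<longleftrightarrow> compact_op (bergman \<alpha>) (bergman \<alpha>) W"
proof (cases "bounded_op (bergman \<alpha>) (bergman \<alpha>) W")
  case True
  have contJ: "AE z in \<mu>. (\<lambda>n. J (F n) z) \<longlonglongrightarrow> J f z"
    if F: "\<And>n. F n \<in> vecs (bergman \<alpha>)" and f: "f \<in> vecs (bergman \<alpha>)"
      and lim: "\<And>z. z \<in> ball 0 1 \<Longrightarrow> (\<lambda>n. F n z) \<longlonglongrightarrow> f z" for F f
  proof -
    have "AE z in \<mu>. \<forall>n. J (F n) z = cut_off (F n) z"
      unfolding AE_all_countable using J_eq_cut_off [OF F] by blast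
    then show ?thesis
      using J_eq_cut_off [OF f] AE_\<mu>_ball
      by eventually_elim (simp add: cut_off_def lim)
  qed
  have contW: "AE z in A. (\<lambda>n. W (F n) z) \<longlonglongrightarrow> W f z"
    if lim: "\<And>z. z \<in> ball 0 1 \<Longrightarrow> (\<lambda>n. F n z) \<longlonglongrightarrow> f z" for F f
    using \<phi>_ball unfolding weighted_comp_def by (intro AE_I2 tendsto_mult_left lim) (auto simp: image_subset_iff)
  have "compact_op (bergman \<alpha>) (L2 \<mu>) J \<longleftrightarrow>
    (\<forall>F :: nat \<Rightarrow> complex \<Rightarrow> complex. (\<forall>n. F n \<in> vecs (bergman \<alpha>)) \<and> (\<exists>B. \<forall>n. hnorm (bergman \<alpha>) (F n) \<le> B) \<longrightarrow>
      (\<exists>r f. strict_mono r \<and> f \<in> vecs (bergman \<alpha>) \<and>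
        (\<lambda>n. hnorm (L2 \<mu>) (\<lambda>z. J (F (r n)) z - J f z)) \<longlonglongrightarrow> 0))"
    using True by (intro compact_op_iff_subsequence [where M = \<mu>] contJ) (auto simp: bounded_J_iff)
  also have "\<dots> \<longleftrightarrow>
    (\<forall>F :: nat \<Rightarrow> complex \<Rightarrow> complex. (\<forall>n. F n \<in> vecs (bergman \<alpha>)) \<and> (\<exists>B. \<forall>n. hnorm (bergman \<alpha>) (F n) \<le> B) \<longrightarrow>
      (\<exists>r f. strict_mono r \<and> f \<in> vecs (bergman \<alpha>) \<and>
        (\<lambda>n. hnorm (bergman \<alpha>) (\<lambda>z. W (F (r n)) z - W f z)) \<longlonglongrightarrow> 0))"
    by (simp add: hnorm_J_diff cong: conj_cong)
  also have "\<dots> \<longleftrightarrow> compact_op (bergman \<alpha>) (bergman \<alpha>) W"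
    using True
    by (intro compact_op_iff_subsequence [where M = A, symmetric] contW)
      (auto simp: vecs_bergman_iff intro!: hnorm_bergman_eq_L2 borel_measurable_diff
        intro: holomorphic_measurable_area_measure)
  finally show ?thesis .
qed (auto simp: compact_op_def bounded_J_iff)

text \<open>The equation T* T e = sigma^2 e, tested against all x, involves the target space only
  through the inner products of T x and T e. These agree for \<open>J\<close> and \<open>W\<close>,
  so the eigenspaces are literally the same sets.\<close>

lemma schatten_J_iff:
  "schatten_op p (bergman \<alpha>) (L2 \<mu>) J \<longleftrightarrow> schatten_op p (bergman \<alpha>) (bergman \<alpha>) W"
proof -
  have "sing_space (bergman \<alpha>) (L2 \<mu>) J \<sigma> = sing_space (bergman \<alpha>) (bergman \<alpha>) W \<sigma>" for \<sigma>
    by (auto simp: sing_space_def adjoint_at_def ip_J)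
  then show ?thesis
    by (simp add: schatten_op_def singular_values_def compact_J_iff)
qed

end

text \<open>A bounded extension acts as the identity and so shares its properties with
  \<open>W\<close>; conversely \<open>cut_off\<close> is an extension acting as the identity and
  inherits those of \<open>W\<close>. The compact and Schatten cases follow the same pattern, since
  both properties include boundedness.\<close>

lemma carleson_bounded_iff: "carleson_bounded \<alpha> \<mu> \<longleftrightarrow> bounded_op (bergman \<alpha>) (bergman \<alpha>) W"
  unfolding carleson_bounded_def
  using bounded_extension_represents_identity bounded_J_iff
    extends_carleson_cut_off represents_identity_cut_off by blast

lemma carleson_compact_iff: "carleson_compact \<alpha> \<mu> \<longleftrightarrow> compact_op (bergman \<alpha>) (bergman \<alpha>) W"
  unfolding carleson_compact_def
  using bounded_extension_represents_identity compact_J_iff compact_op_def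
    extends_carleson_cut_off represents_identity_cut_off by metis

lemma carleson_schatten_iff:
  "carleson_schatten p \<alpha> \<mu> \<longleftrightarrow> schatten_op p (bergman \<alpha>) (bergman \<alpha>) W"
  unfolding carleson_schatten_def
  using bounded_extension_represents_identity schatten_J_iff compact_op_def schatten_op_def
    extends_carleson_cut_off represents_identity_cut_off by metis

text \<open>\<open>W\<close> need not be bounded here. Instead \<open>f\<close> is bounded on the
  compact disc and \<open>\<mu>\<close> is finite, which puts \<open>f\<close> into
  \<open>L2 \<mu>\<close>, and the change of variables then puts \<open>W f\<close> into the Bergman
  space.\<close>

lemma analytic_on_cdisc:
  assumes f: "f analytic_on cball 0 1"
  shows "W f \<in> vecs (bergman \<alpha>)" and "f \<in> vecs (L2 \<mu>)"
    and "hnorm (bergman \<alpha>) (W f) = hnorm (L2 \<mu>) f"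
proof -
  have cont: "continuous_on (cball 0 1) f"
    using f by (intro holomorphic_on_imp_continuous_on analytic_imp_holomorphic)
  have hol: "f holomorphic_on ball 0 1"
    using analytic_imp_holomorphic [OF f] ball_subset_cball holomorphic_on_subset by blast
  have meas: "f \<in> borel_measurable \<mu>"
    unfolding \<mu>_measurable_cong by (rule borel_measurable_continuous_on_restrict [OF cont])
  interpret finite_measure \<mu>
    using finite_borel_\<mu> by (simp add: finite_borel_cdisc_def)
  obtain B where B: "\<And>z. z \<in> cball 0 1 \<Longrightarrow> cmod (f z) \<le> B"
    using compact_imp_bounded [OF compact_continuous_image [OF cont compact_cball]]
    unfolding bounded_iff by blast
  have "integrable \<mu> (\<lambda>z. (cmod (f z))\<^sup>2)"
    by (rule integrable_const_bound [where B = "B\<^sup>2"])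
      (use meas B in \<open>auto intro!: AE_I2 power_mono\<close>)
  with meas show L2: "f \<in> vecs (L2 \<mu>)"
    by (simp add: L2_def)
  have "nn_sq \<mu> (cut_off f) = nn_sq \<mu> f"
    unfolding nn_sq_def using AE_\<mu>_cut_off [of f]
    by (intro nn_integral_cong_AE) (auto elim!: eventually_mono)
  with L2 show W: "W f \<in> vecs (bergman \<alpha>)"
    by (simp add: W_in_bergman_iff hol vecs_L2_iff cut_off_measurable)
  have "hnorm (bergman \<alpha>) (W f) = hnorm (L2 \<mu>) (cut_off f)"
    by (simp add: hnorm_def ip_cut_off hol)
  also have "\<dots> = hnorm (L2 \<mu>) f"
    by (intro hnorm_L2_cong_AE AE_\<mu>_cut_off cut_off_measurable hol meas)
  finally show "hnorm (bergman \<alpha>) (W f) = hnorm (L2 \<mu>) f" .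
qed

end

theorem corollary3p3:
  fixes \<alpha> :: real and \<phi> h :: "complex \<Rightarrow> complex"
  assumes "\<alpha> > -1"
    and "\<phi> holomorphic_on ball 0 1"
    and "\<phi> ` ball 0 1 \<subseteq> ball 0 1"
    and "h \<in> vecs (bergman \<alpha>)"
  shows "\<exists>\<mu>. finite_borel_cdisc \<mu> \<and>
    (\<forall>f. f analytic_on cball 0 1 \<longrightarrow>
       weighted_comp h \<phi> f \<in> vecs (bergman \<alpha>) \<and> f \<in> vecs (L2 \<mu>) \<and>
       (hnorm (bergman \<alpha>) (weighted_comp h \<phi> f))\<^sup>2 = (LINT z|\<mu>. (cmod (f z))\<^sup>2) \<and>
       hnorm (bergman \<alpha>) (weighted_comp h \<phi> f) = hnorm (L2 \<mu>) f) \<and>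
    (bounded_op (bergman \<alpha>) (bergman \<alpha>) (weighted_comp h \<phi>) \<longleftrightarrow> carleson_bounded \<alpha> \<mu>) \<and>
    (compact_op (bergman \<alpha>) (bergman \<alpha>) (weighted_comp h \<phi>) \<longleftrightarrow> carleson_compact \<alpha> \<mu>) \<and>
    (\<forall>p\<ge>1. schatten_op p (bergman \<alpha>) (bergman \<alpha>) (weighted_comp h \<phi>) \<longleftrightarrow>
            carleson_schatten p \<alpha> \<mu>)"
proof -
  interpret weighted_composition \<alpha> h \<phi>
    by unfold_locales (use assms in auto)
  have "(hnorm (L2 \<mu>) f)\<^sup>2 = (LINT z|\<mu>. (cmod (f z))\<^sup>2)" for f
    by (simp add: hnorm_L2)
  then show ?thesis
    by (intro exI [of _ \<mu>])
      (simp add: finite_borel_\<mu> analytic_on_cdisc carleson_bounded_iff carleson_compact_iff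
        carleson_schatten_iff)
qed

end
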